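(* Let $n\ge 1$ and let $$\phi(z)=z^h\,\frac{p^{\sim}(z)}{p(z)}\qquad\text{and}\qquad \psi(z)=z^e\,\frac{q^{\sim}(z)}{q(z)}$$ be two rational inner functions on $\mathbb{D}^n$, where $p,q\in\mathbb{C}[z_1,\dots,z_n]$ do not vanish on $\mathbb{D}^n$ and $h,e$ are $n$-tuples of nonnegative integers. Then $\phi$ and $\psi$ are essentially equal (that is, $\phi=c\,\psi$ for some nonzero constant $c\in\mathbb{C}$) if and only if $p$ and $q$ have the same atoral factor (up to a nonzero multiplicative constant) and $h=e$.
   Context: $\mathbb{D}$ is the open unit disk, $\mathbb{T}$ the unit circle. An inner function on $\mathbb{D}^n$ is a bounded holomorphic function on $\mathbb{D}^n$ whose radial boundary values have modulus one almost everywhere on $\mathbb{T}^n$; it is rational if it is a quotient of polynomials. For $d=(d_1,\dots,d_n)$, $z^d=z_1^{d_1}\cdots z_n^{d_n}$, and $1/\overline{z}=(1/\overline{z_1},\dots,1/\overline{z_n})$. For a nonzero polynomial $p$ of (multi-)degree $d=(d_1,\dots,d_n)$ ($d_i$ the degree of $p$ in $z_i$), $p^{\sim}$ is the polynomial $p^{\sim}(z)=z^d\,\overline{p(1/\overline{z})}$. An algebraic set in $\mathbb{C}^n$ is a finite intersection of zero sets of polynomials; $Z_p$ is the zero set of $p$. For an algebraic set $A$, $Hol(A)$ is the algebra of functions $f:A\to\mathbb{C}$ such that every $\lambda\in A$ has an open neighborhood $U$ in $\mathbb{C}^n$ and a holomorphic $g$ on $U$ with $g|_{U\cap A}=f|_{U\cap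 A}$. A set $X\subseteq\mathbb{C}^n$ (not necessarily contained in $A$) is determining for $A$ if $f\equiv 0$ whenever $f\in Hol(A)$ and $f|_{X\cap A}=0$. $A$ is toral if $\mathbb{T}^n$ is determining for $A$; $A$ is atoral if $\mathbb{T}^n$ is not determining for any irreducible component of $A$. A polynomial $p$ is toral (atoral) if $Z_p$ is. Every nonzero polynomial $p$ factors as $p=ab$ with $a$ toral and $b$ atoral, and $a,b$ are unique up to nonzero multiplicative constants; $b$ is the atoral factor of $p$. *)

theory Defs
  imports "HOL-Analysis.Analysis" "HOL-Library.Poly_Mapping"
begin

text \<open>
  The dimension is the number of elements of the finite index type, which is at least 1.
  A polynomial is a finitely supported family of coefficients indexed by exponent tuples;
  the multiplication of the type is convolution, hence the product of polynomials.
\<close>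

type_synonym 'n mpoly = "('n \<Rightarrow>\<^sub>0 nat) \<Rightarrow>\<^sub>0 complex"

definition monom_at :: "complex ^ 'n \<Rightarrow> ('n::finite \<Rightarrow>\<^sub>0 nat) \<Rightarrow> complex" where
  "monom_at z m = (\<Prod>i\<in>UNIV. (z $ i) ^ Poly_Mapping.lookup m i)"

definition eval_mpoly :: "'n::finite mpoly \<Rightarrow> complex ^ 'n \<Rightarrow> complex" where
  "eval_mpoly p z = (\<Sum>m\<in>Poly_Mapping.keys p. Poly_Mapping.lookup p m * monom_at z m)"

definition const_mpoly :: "complex \<Rightarrow> 'n::finite mpoly" where
  "const_mpoly c = Poly_Mapping.single 0 c"

text \<open>The inserted 0 only matters for the zero polynomial, whose multidegree is set to 0.\<close>

definition multidegree :: "'n::finite mpoly \<Rightarrow> ('n \<Rightarrow>\<^sub>0 nat)" where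
  "multidegree p = Poly_Mapping.Abs_poly_mapping
     (\<lambda>i. Max (insert 0 ((\<lambda>m. Poly_Mapping.lookup m i) ` Poly_Mapping.keys p)))"

text \<open>
  The reflection of \<open>p\<close>, i.e. the polynomial
  \<open>z\<^sup>d * cnj (p (1 / cnj z))\<close> for the multidegree \<open>d\<close> of \<open>p\<close>; the
  lemma \<open>eval_reflection\<close> below states this formula. The subtraction of exponent
  tuples is componentwise and not truncated here, as all exponents of \<open>p\<close> are at most \<open>d\<close>.
\<close>

definition reflection :: "'n::finite mpoly \<Rightarrow> 'n mpoly" where
  "reflection p = (\<Sum>m\<in>Poly_Mapping.keys p.
     Poly_Mapping.single (multidegree p - m) (cnj (Poly_Mapping.lookup p m)))"

lemma lookup_multidegree:
  "Poly_Mapping.lookup (multidegree p) i =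
     Max (insert 0 ((\<lambda>m. Poly_Mapping.lookup m i) ` Poly_Mapping.keys p))"
  unfolding multidegree_def by (subst Abs_poly_mapping_inverse) auto

lemma lookup_le_multidegree:
  assumes "m \<in> Poly_Mapping.keys p"
  shows "Poly_Mapping.lookup m i \<le> Poly_Mapping.lookup (multidegree p) i"
  unfolding lookup_multidegree using assms by (intro Max_ge) auto

lemma eval_mpoly_superset:
  assumes "finite S" "Poly_Mapping.keys p \<subseteq> S"
  shows "eval_mpoly p z = (\<Sum>m\<in>S. Poly_Mapping.lookup p m * monom_at z m)"
  unfolding eval_mpoly_def using assms
  by (intro sum.mono_neutral_left) (auto simp: in_keys_iff)

lemma eval_mpoly_add: "eval_mpoly (p + q) z = eval_mpoly p z + eval_mpoly q z"
proof -
  let ?S = "Poly_Mapping.keys p \<union> Poly_Mapping.keys q"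
  have "eval_mpoly (p + q) z = (\<Sum>m\<in>?S. Poly_Mapping.lookup (p + q) m * monom_at z m)"
    using Poly_Mapping.keys_add[of p q] by (intro eval_mpoly_superset) auto
  also have "\<dots> = (\<Sum>m\<in>?S. Poly_Mapping.lookup p m * monom_at z m)
      + (\<Sum>m\<in>?S. Poly_Mapping.lookup q m * monom_at z m)"
    by (simp add: lookup_add algebra_simps sum.distrib)
  also have "\<dots> = eval_mpoly p z + eval_mpoly q z"
    by (subst (1 2) eval_mpoly_superset[of ?S]) auto
  finally show ?thesis .
qed

lemma eval_mpoly_zero: "eval_mpoly 0 z = 0"
  by (simp add: eval_mpoly_def)

lemma eval_mpoly_sum: "eval_mpoly (\<Sum>x\<in>A. f x) z = (\<Sum>x\<in>A. eval_mpoly (f x) z)"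
  by (induction A rule: infinite_finite_induct) (auto simp: eval_mpoly_add eval_mpoly_zero)

lemma eval_mpoly_single: "eval_mpoly (Poly_Mapping.single m c) z = c * monom_at z m"
  by (simp add: eval_mpoly_def)

lemma eval_reflection:
  fixes p :: "'n::finite mpoly"
  assumes "\<And>i. z $ i \<noteq> 0"
  shows "eval_mpoly (reflection p) z =
    monom_at z (multidegree p) * cnj (eval_mpoly p (\<chi> i. 1 / cnj (z $ i)))"
proof -
  have "monom_at z (multidegree p - m) =
      monom_at z (multidegree p) * cnj (monom_at (\<chi> i. 1 / cnj (z $ i)) m)"
    if "m \<in> Poly_Mapping.keys p" for m
    using lookup_le_multidegree[OF that] assms
    by (simp add: monom_at_def lookup_minus power_diff power_one_over divide_inverse
        prod.distrib[symmetric] power_inverse)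
  then show ?thesis
    by (simp add: reflection_def eval_mpoly_sum eval_mpoly_single eval_mpoly_def[of p]
        sum_distrib_left mult_ac)
qed

definition polydisc :: "(complex ^ 'n::finite) set" where
  "polydisc = {z. \<forall>i. norm (z $ i) < 1}"

definition torus :: "(complex ^ 'n::finite) set" where
  "torus = {z. \<forall>i. norm (z $ i) = 1}"

text \<open>Holomorphy: complex (Frechet) differentiability at every point; used for open sets only.\<close>

definition holomorphic_mv :: "(complex ^ 'n::finite \<Rightarrow> complex) \<Rightarrow> (complex ^ 'n) set \<Rightarrow> bool" where
  "holomorphic_mv f U \<longleftrightarrow>
     (\<forall>z\<in>U. \<exists>L. (f has_derivative L) (at z) \<and> (\<forall>c v. L (c *s v) = c * L v))"

text \<open>
  The torus is parametrized by the angle vector \<open>t\<close>. As the parametrization is periodic,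
  a property holds for almost every \<open>t\<close> in the whole space iff it does so for
  almost every \<open>t\<close> in one period box, i.e. almost everywhere on the torus.
\<close>

definition torus_point :: "real ^ 'n \<Rightarrow> complex ^ 'n::finite" where
  "torus_point t = (\<chi> i. cis (t $ i))"

definition inner_function :: "(complex ^ 'n::finite \<Rightarrow> complex) \<Rightarrow> bool" where
  "inner_function f \<longleftrightarrow>
     holomorphic_mv f polydisc \<and> bounded (f ` polydisc) \<and>
     (AE t in (lborel :: (real ^ 'n) measure).
        \<exists>l. ((\<lambda>r::real. f (r *\<^sub>R torus_point t)) \<longlongrightarrow> l) (at_left 1) \<and> norm l = 1)"

definition rational_inner_function :: "(complex ^ 'n::finite \<Rightarrow> complex) \<Rightarrow> bool" where
  "rational_inner_function f \<longleftrightarrow> inner_function f \<and>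
     (\<exists>r s. s \<noteq> 0 \<and>
        (\<forall>z\<in>polydisc. eval_mpoly s z \<noteq> 0 \<longrightarrow> f z = eval_mpoly r z / eval_mpoly s z))"

definition zero_set :: "'n::finite mpoly \<Rightarrow> (complex ^ 'n) set" where
  "zero_set p = {z. eval_mpoly p z = 0}"

definition algebraic_set :: "(complex ^ 'n::finite) set \<Rightarrow> bool" where
  "algebraic_set A \<longleftrightarrow> (\<exists>P. finite P \<and> A = (\<Inter>p\<in>P. zero_set p))"

definition irreducible_algebraic_set :: "(complex ^ 'n::finite) set \<Rightarrow> bool" where
  "irreducible_algebraic_set A \<longleftrightarrow> algebraic_set A \<and> A \<noteq> {} \<and>
     (\<forall>B C. algebraic_set B \<longrightarrow> algebraic_set C \<longrightarrow> A = B \<union> C \<longrightarrow> B = A \<or> C = A)"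

definition irreducible_component ::
    "(complex ^ 'n::finite) set \<Rightarrow> (complex ^ 'n) set \<Rightarrow> bool" where
  "irreducible_component W A \<longleftrightarrow> irreducible_algebraic_set W \<and> W \<subseteq> A \<and>
     (\<forall>V. irreducible_algebraic_set V \<longrightarrow> W \<subseteq> V \<longrightarrow> V \<subseteq> A \<longrightarrow> V = W)"

text \<open>A function on \<open>A\<close> is represented by a total function; its values off \<open>A\<close> are ignored.\<close>

definition Hol :: "(complex ^ 'n::finite) set \<Rightarrow> (complex ^ 'n \<Rightarrow> complex) set" where
  "Hol A = {f. \<forall>w\<in>A. \<exists>U g. open U \<and> w \<in> U \<and> holomorphic_mv g U \<and> (\<forall>z\<in>U \<inter> A. g z = f z)}"

definition determining :: "(complex ^ 'n::finite) set \<Rightarrow> (complex ^ 'n) set \<Rightarrow> bool" where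
  "determining X A \<longleftrightarrow> (\<forall>f\<in>Hol A. (\<forall>z\<in>X \<inter> A. f z = 0) \<longrightarrow> (\<forall>z\<in>A. f z = 0))"

definition toral_set :: "(complex ^ 'n::finite) set \<Rightarrow> bool" where
  "toral_set A \<longleftrightarrow> algebraic_set A \<and> determining torus A"

definition atoral_set :: "(complex ^ 'n::finite) set \<Rightarrow> bool" where
  "atoral_set A \<longleftrightarrow> algebraic_set A \<and> (\<forall>W. irreducible_component W A \<longrightarrow> \<not> determining torus W)"

definition toral :: "'n::finite mpoly \<Rightarrow> bool" where
  "toral p \<longleftrightarrow> toral_set (zero_set p)"

definition atoral :: "'n::finite mpoly \<Rightarrow> bool" where
  "atoral p \<longleftrightarrow> atoral_set (zero_set p)"

text \<open>
  Nonzero constants are both toral and atoral (their zero set is empty), so the atoral factor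
  is only determined up to a nonzero constant; hence a relation, not a function.
\<close>

definition is_atoral_factor :: "'n::finite mpoly \<Rightarrow> 'n mpoly \<Rightarrow> bool" where
  "is_atoral_factor b p \<longleftrightarrow> p \<noteq> 0 \<and> atoral b \<and> (\<exists>a. toral a \<and> p = a * b)"

definition same_atoral_factor :: "'n::finite mpoly \<Rightarrow> 'n mpoly \<Rightarrow> bool" where
  "same_atoral_factor p q \<longleftrightarrow>
     (\<exists>b b' c. is_atoral_factor b p \<and> is_atoral_factor b' q \<and> c \<noteq> 0 \<and> b' = const_mpoly c * b)"

end

theory Submission
  imports
    Defs
    "HOL-Computational_Algebra.Polynomial"
    "HOL-Computational_Algebra.Factorial_Ring"
    "HOL-Computational_Algebra.Fundamental_Theorem_Algebra"
    "HOL-Complex_Analysis.Residue_Theorem"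
begin

text \<open>
  Write \<open>p~\<close> for the reflection of \<open>p\<close>, \<open>Z\<close> for zero sets and \<open>T\<close> for the torus. Call \<open>a\<close>
  self-reflective if \<open>a~\<close> is a nonzero constant multiple of \<open>a\<close>. An irreducible \<open>r\<close> is
  self-reflective as soon as it divides \<open>r~\<close>, because \<open>r~\<close> has no larger degrees than \<open>r\<close>. Collecting
  the self-reflective irreducible factors of \<open>p\<close> in \<open>a\<close> and the others in \<open>b\<close> gives \<open>p = a b\<close>, and
  \<open>p~/p\<close> is a constant times \<open>b~/b\<close>. So the theorem follows once \<open>a\<close> is known to be toral, \<open>b\<close> to be
  atoral, toral factors to be self-reflective, and \<open>b\<close> to be determined up to a constant by
  \<open>b~/b\<close> up to a constant.

  On the torus \<open>|p~| = |p|\<close>, so \<open>r~\<close> vanishes on \<open>T \<inter> Z(r)\<close>. If the torus determines \<open>Z(r)\<close>, then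
  \<open>r~\<close> vanishes on \<open>Z(r)\<close>, and for irreducible \<open>r\<close> the Nullstellensatz
  (\<open>irreducible_nullstellensatz\<close>) gives that \<open>r\<close> divides \<open>r~\<close>. As the irreducible components of
  \<open>Z(b)\<close> are the sets \<open>Z(r)\<close> for the irreducible factors \<open>r\<close> of \<open>b\<close>, this shows that \<open>b\<close> is atoral
  (\<open>atoralI\<close>); a variant shows that toral polynomials are self-reflective
  (\<open>toral_imp_self_reflective\<close>).

  That a self-reflective \<open>a\<close> without zeros in the polydisc is toral
  (\<open>self_reflective_imp_toral\<close>) is the analytic core. For \<open>z\<close> in the torus every root \<open>w\<close> of
  \<open>w \<mapsto> a(w z)\<close> lies on the unit circle: roots inside are excluded as the polydisc contains no zeros, and
  reflection maps roots outside to roots inside. Hence a function \<open>f\<close> on \<open>Z(a)\<close> that vanishes on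
  \<open>T \<inter> Z(a)\<close> vanishes at all points of \<open>Z(a)\<close> on the line through \<open>z\<close>. Now move \<open>z\<close> along a holomorphic
  curve \<open>x(s)\<close> in the complement of the coordinate hyperplanes which maps the imaginary axis to the torus
  and passes at \<open>s = 1\<close> through a given point of \<open>Z(a)\<close> off these
  hyperplanes; the other points of \<open>Z(a)\<close> are limits of such points. The sum of \<open>f(w x(s)) H(w)\<close> over the
  roots \<open>w\<close> of \<open>w \<mapsto> a(w x(s))\<close>, counted with multiplicity, is an entire function of \<open>s\<close>
  for each polynomial \<open>H\<close>, because no root escapes to infinity: it would be
  reflected to a zero of \<open>a\<close> near 0. The sum is zero on the imaginary axis, hence
  at \<open>s = 1\<close>, where a suitable \<open>H\<close> isolates the value of \<open>f\<close> at the given point. The summation over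
  all roots treats reducible hypersurfaces and all their branches at once.

  For the uniqueness of \<open>b\<close> let \<open>b~ b' = k b'~ b\<close>. An irreducible factor \<open>r\<close> of \<open>b\<close> divides \<open>b~\<close> or \<open>b'\<close>.
  In the first case \<open>r~\<close> divides \<open>b\<close>, so neither \<open>r\<close> nor \<open>r~\<close> has zeros in the polydisc, which forces
  \<open>r\<close> to be self-reflective (\<open>zero_free_reflection_imp_self_reflective\<close>), a contradiction. So \<open>r\<close> can be
  cancelled from \<open>b\<close> and \<open>b'\<close>. Finally, \<open>h = e\<close> follows from the identity
  \<open>z\<^sup>h p~ q = c z\<^sup>e q~ p\<close>: reflection removes the monomials and turns it into \<open>p q~ = c' q p~\<close>, and
  the two identities leave \<open>z\<^sup>h = c c' z\<^sup>e\<close>.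

  All of this rests on unique factorization in several variables, which is proved by adding one
  variable at a time. The key is the identity \<open>c = \<alpha> f + \<beta> r\<close> with a nonzero \<open>c\<close> in which the chosen variable
  is eliminated (\<open>bezout_eliminant\<close>); it yields both the primality of irreducible polynomials
  and the Nullstellensatz for one irreducible polynomial.
\<close>

(* only vectors are indexed with $ below *)
no_notation fps_nth (infixl \<open>$\<close> 75)

section \<open>Polynomials as functions\<close>

lemma poly_mapping_sum_single:
  fixes p :: "'k \<Rightarrow>\<^sub>0 'b::comm_monoid_add"
  shows "p = (\<Sum>m\<in>Poly_Mapping.keys p. Poly_Mapping.single m (Poly_Mapping.lookup p m))"
proof (rule poly_mapping_eqI)
  fix k
  have "Poly_Mapping.lookup (\<Sum>m\<in>Poly_Mapping.keys p. Poly_Mapping.single m (Poly_Mapping.lookup p m)) k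
      = (\<Sum>m\<in>Poly_Mapping.keys p. if m = k then Poly_Mapping.lookup p m else 0)"
    by (simp add: lookup_sum lookup_single when_def)
  then show "Poly_Mapping.lookup p k = Poly_Mapping.lookup (\<Sum>m\<in>Poly_Mapping.keys p. Poly_Mapping.single m (Poly_Mapping.lookup p m)) k"
    by (simp add: in_keys_iff)
qed

lemma monom_at_add: "monom_at z (m + m') = monom_at z m * monom_at z m'"
  by (simp add: monom_at_def lookup_add power_add prod.distrib)

lemma monom_at_0 [simp]: "monom_at z 0 = 1"
  by (simp add: monom_at_def)

lemma monom_at_eq_0_iff: "monom_at z m = 0 \<longleftrightarrow> (\<exists>i. Poly_Mapping.lookup m i \<noteq> 0 \<and> z $ i = 0)"
  by (auto simp: monom_at_def)

lemma eval_mpoly_mult: "eval_mpoly (p * q) z = eval_mpoly p z * eval_mpoly q z"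
proof -
  let ?s = "\<lambda>p m. Poly_Mapping.single m (Poly_Mapping.lookup p m)"
  have "p * q = (\<Sum>m\<in>Poly_Mapping.keys p. ?s p m) * (\<Sum>m'\<in>Poly_Mapping.keys q. ?s q m')"
    using poly_mapping_sum_single[of p] poly_mapping_sum_single[of q] by simp
  also have "\<dots> = (\<Sum>m\<in>Poly_Mapping.keys p. \<Sum>m'\<in>Poly_Mapping.keys q.
      Poly_Mapping.single (m + m') (Poly_Mapping.lookup p m * Poly_Mapping.lookup q m'))"
    by (simp add: sum_product mult_single)
  finally have "eval_mpoly (p * q) z = (\<Sum>m\<in>Poly_Mapping.keys p. \<Sum>m'\<in>Poly_Mapping.keys q.
      (Poly_Mapping.lookup p m * monom_at z m) * (Poly_Mapping.lookup q m' * monom_at z m'))"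
    by (simp add: eval_mpoly_sum eval_mpoly_single monom_at_add mult_ac)
  then show ?thesis
    by (simp add: eval_mpoly_def sum_product)
qed

lemma eval_mpoly_const [simp]: "eval_mpoly (const_mpoly c) z = c"
  by (simp add: const_mpoly_def eval_mpoly_single)

lemma eval_mpoly_0 [simp]: "eval_mpoly 0 z = 0"
  by (rule eval_mpoly_zero)

lemma eval_mpoly_1 [simp]: "eval_mpoly 1 z = 1"
  by (simp add: eval_mpoly_def lookup_one)

lemma eval_mpoly_uminus: "eval_mpoly (- p) z = - eval_mpoly p z"
  using eval_mpoly_add[of p "- p" z] by (simp add: eq_neg_iff_add_eq_0 add.commute)

lemma eval_mpoly_diff: "eval_mpoly (p - q) z = eval_mpoly p z - eval_mpoly q z"
  using eval_mpoly_add[of p "- q" z] by (simp add: eval_mpoly_uminus)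

lemma eval_mpoly_power: "eval_mpoly (p ^ k) z = eval_mpoly p z ^ k"
  by (induction k) (auto simp: eval_mpoly_mult)

lemma const_mpoly_0 [simp]: "const_mpoly 0 = 0"
  by (simp add: const_mpoly_def)

lemma const_mpoly_1 [simp]: "const_mpoly 1 = 1"
  by (simp add: const_mpoly_def)

definition set_coord :: "complex ^ 'n \<Rightarrow> 'n::finite \<Rightarrow> complex \<Rightarrow> complex ^ 'n" where
  "set_coord z i t = (\<chi> j. if j = i then t else z $ j)"

lemma set_coord_nth: "set_coord z i t $ j = (if j = i then t else z $ j)"
  by (simp add: set_coord_def)

lemma monom_at_set_coord: "monom_at (set_coord z i (w * z $ i)) m = w ^ Poly_Mapping.lookup m i * monom_at z m"
proof -
  have "monom_at (set_coord z i (w * z $ i)) m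
      = (\<Prod>j\<in>UNIV. (if j = i then w ^ Poly_Mapping.lookup m i else 1) * z $ j ^ Poly_Mapping.lookup m j)"
    unfolding monom_at_def by (rule prod.cong) (auto simp: set_coord_nth power_mult_distrib)
  then show ?thesis
    by (simp add: prod.distrib monom_at_def)
qed

text \<open>
  Replacing the coordinate \<open>z $ i\<close> by \<open>w * z $ i\<close> multiplies each monomial by a power of \<open>w\<close>. Subtracting
  the right multiple of the original relation therefore removes one monomial and keeps a nonzero multiple of
  any other one that differs from it in the exponent of \<open>i\<close>. The closure condition on \<open>X\<close> is stated so that it
  covers both the torus and the part of the polydisc off the coordinate hyperplanes.
\<close>

lemma monomials_independent:
  fixes X :: "(complex ^ 'n::finite) set" and c :: "('n \<Rightarrow>\<^sub>0 nat) \<Rightarrow> complex"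
  assumes "z0 \<in> X" and nz: "\<And>z i. z \<in> X \<Longrightarrow> z $ i \<noteq> 0"
    and rot: "\<And>a b. a < (b::nat) \<Longrightarrow> \<exists>w. w ^ a \<noteq> w ^ b \<and> (\<forall>z\<in>X. \<forall>i. set_coord z i (w * z $ i) \<in> X)"
    and "finite S" "\<And>z. z \<in> X \<Longrightarrow> (\<Sum>m\<in>S. c m * monom_at z m) = 0"
  shows "\<forall>m\<in>S. c m = 0"
  using assms(4,5)
proof (induction S arbitrary: c rule: finite_induct)
  case empty
  then show ?case by simp
next
  case (insert m' S)
  have other: "c m = 0" if m: "m \<in> S" for m
  proof -
    have "m \<noteq> m'" using m insert.hyps by auto
    then obtain i where i: "Poly_Mapping.lookup m i \<noteq> Poly_Mapping.lookup m' i"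
      using poly_mapping_eqI[of m m'] by auto
    have "\<exists>w. w ^ Poly_Mapping.lookup m i \<noteq> w ^ Poly_Mapping.lookup m' i \<and>
        (\<forall>z\<in>X. \<forall>i. set_coord z i (w * z $ i) \<in> X)"
    proof (cases "Poly_Mapping.lookup m i < Poly_Mapping.lookup m' i")
      case True
      then show ?thesis by (rule rot)
    next
      case False
      then have "Poly_Mapping.lookup m' i < Poly_Mapping.lookup m i" using i by simp
      from rot[OF this] show ?thesis by (metis (no_types, lifting))
    qed
    then obtain w where w: "w ^ Poly_Mapping.lookup m i \<noteq> w ^ Poly_Mapping.lookup m' i"
      "\<forall>z\<in>X. \<forall>i. set_coord z i (w * z $ i) \<in> X"
      by blast
    \<comment> \<open>coefficients of the rotated relation minus the multiple of the original one that cancels \<open>m'\<close>\<close>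
    define d where "d k = c k * (w ^ Poly_Mapping.lookup k i - w ^ Poly_Mapping.lookup m' i)" for k
    have "(\<Sum>k\<in>S. d k * monom_at z k) = 0" if z: "z \<in> X" for z
    proof -
      have "set_coord z i (w * z $ i) \<in> X" using w z by blast
      then have "(\<Sum>k\<in>insert m' S. c k * monom_at (set_coord z i (w * z $ i)) k) = 0"
        by (rule insert.prems)
      then have e1: "(\<Sum>k\<in>insert m' S. c k * w ^ Poly_Mapping.lookup k i * monom_at z k) = 0"
        by (simp add: monom_at_set_coord mult_ac)
      have e2: "w ^ Poly_Mapping.lookup m' i * (\<Sum>k\<in>insert m' S. c k * monom_at z k) = 0"
        using insert.prems[OF z] by simp
      have "(\<Sum>k\<in>insert m' S. d k * monom_at z k) = 
        (\<Sum>k\<in>insert m' S. c k * w ^ Poly_Mapping.lookup k i * monom_at z k)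
        - w ^ Poly_Mapping.lookup m' i * (\<Sum>k\<in>insert m' S. c k * monom_at z k)"
        by (simp add: d_def sum_distrib_left sum_subtractf[symmetric] algebra_simps del: sum.insert)
      also have "\<dots> = 0" using e1 e2 by simp
      finally show ?thesis
        using insert.hyps by (simp add: d_def)
    qed
    then have "d m = 0" using insert.IH m by blast
    then show ?thesis using w(1) by (simp add: d_def)
  qed
  have "c m' * monom_at z0 m' = 0"
    using insert.prems[OF \<open>z0 \<in> X\<close>] insert.hyps other by simp
  moreover have "monom_at z0 m' \<noteq> 0"
    using nz[OF \<open>z0 \<in> X\<close>] by (simp add: monom_at_eq_0_iff)
  ultimately show ?case using other by simp
qed

lemma mpoly_eq_0I:
  fixes X :: "(complex ^ 'n::finite) set"
  assumes "z0 \<in> X" and "\<And>z i. z \<in> X \<Longrightarrow> z $ i \<noteq> 0"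
    and "\<And>a b. a < (b::nat) \<Longrightarrow> \<exists>w. w ^ a \<noteq> w ^ b \<and> (\<forall>z\<in>X. \<forall>i. set_coord z i (w * z $ i) \<in> X)"
    and "\<And>z. z \<in> X \<Longrightarrow> eval_mpoly p z = 0"
  shows "p = 0"
proof -
  have "\<forall>m\<in>Poly_Mapping.keys p. Poly_Mapping.lookup p m = 0"
    by (rule monomials_independent[OF assms(1-3)]) (use assms(4) in \<open>auto simp: eval_mpoly_def\<close>)
  then show ?thesis
    by (metis in_keys_iff keys_eq_empty ex_in_conv)
qed

lemma mpoly_eqI_polydisc:
  fixes p q :: "'n::finite mpoly"
  assumes "\<And>z. z \<in> polydisc \<Longrightarrow> (\<And>i. z $ i \<noteq> 0) \<Longrightarrow> eval_mpoly p z = eval_mpoly q z"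
  shows "p = q"
proof -
  let ?X = "{z :: complex ^ 'n. z \<in> polydisc \<and> (\<forall>i. z $ i \<noteq> 0)}"
  have "p - q = 0"
  proof (rule mpoly_eq_0I[of "\<chi> i. 1/2" ?X])
    show "(\<chi> i. 1/2) \<in> ?X" by (auto simp: polydisc_def)
    show "z $ i \<noteq> 0" if "z \<in> ?X" for z i using that by auto
    show "eval_mpoly (p - q) z = 0" if "z \<in> ?X" for z
      using assms that by (auto simp: eval_mpoly_diff)
    fix a b :: nat assume "a < b"
    have "(1/2::complex) ^ a \<noteq> (1/2) ^ b"
    proof
      assume "(1/2::complex) ^ a = (1/2) ^ b"
      then have "norm ((1/2::complex) ^ a) = norm ((1/2::complex) ^ b)" by simp
      then have "(1/2::real) ^ a = (1/2) ^ b" by (simp add: norm_power norm_divide)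
      then show False using \<open>a < b\<close> power_strict_decreasing[of a b "1/2::real"] by simp
    qed
    moreover have "\<forall>z\<in>?X. \<forall>i. set_coord z i (1/2 * z $ i) \<in> ?X"
    proof (intro ballI allI)
      fix z i assume z: "z \<in> ?X"
      have "norm (z $ i) < 1" using z by (auto simp: polydisc_def)
      then have "norm (z $ i / 2) < 1" by (simp add: norm_divide)
      then show "set_coord z i (1/2 * z $ i) \<in> ?X" using z
        by (auto simp: polydisc_def set_coord_nth norm_divide)
    qed
    ultimately show "\<exists>w::complex. w ^ a \<noteq> w ^ b \<and> (\<forall>z\<in>?X. \<forall>i. set_coord z i (w * z $ i) \<in> ?X)"
      by blast
  qed
  then show ?thesis by simp
qed

lemma mpoly_eqI:
  assumes "\<And>z. eval_mpoly p z = eval_mpoly q z"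
  shows "p = q"
  using assms by (intro mpoly_eqI_polydisc)

lemma mpoly_eqI_torus:
  fixes p q :: "'n::finite mpoly"
  assumes "\<And>z. z \<in> torus \<Longrightarrow> eval_mpoly p z = eval_mpoly q z"
  shows "p = q"
proof -
  have "p - q = 0"
  proof (rule mpoly_eq_0I[of "\<chi> i. 1" torus])
    show "(\<chi> i. 1) \<in> torus" by (auto simp: torus_def)
    show "z $ i \<noteq> 0" if "z \<in> torus" for z :: "complex ^ 'n" and i
      using that by (auto simp: torus_def dest: spec[of _ i])
    show "eval_mpoly (p - q) z = 0" if "z \<in> torus" for z
      using assms that by (auto simp: eval_mpoly_diff)
    fix a b :: nat assume ab: "a < b"
    \<comment> \<open>the power of \<open>w\<close> with exponent \<open>b - a\<close> is -1, so \<open>w\<close> separates the exponents \<open>a\<close> and \<open>b\<close>\<close>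
    define w where "w = cis (pi / real (b - a))"
    have "real (b - a) * (pi / real (b - a)) = pi" using ab by simp
    then have "w ^ (b - a) = -1" by (simp only: w_def Complex.DeMoivre cis_pi)
    moreover have "w ^ b = w ^ a * w ^ (b - a)" using ab by (simp flip: power_add)
    moreover have "w \<noteq> 0" by (simp add: w_def)
    ultimately have "w ^ a \<noteq> w ^ b" by simp
    moreover have "\<forall>z\<in>torus. \<forall>i. set_coord z i (w * z $ i) \<in> torus"
      by (auto simp: torus_def set_coord_nth norm_mult w_def)
    ultimately show "\<exists>w::complex. w ^ a \<noteq> w ^ b \<and> (\<forall>z\<in>torus. \<forall>i. set_coord z i (w * z $ i) \<in> (torus :: (complex ^ 'n) set))"
      by blast
  qed
  then show ?thesis by simp
qed

definition restrict_curve :: "('n \<Rightarrow> complex poly) \<Rightarrow> 'n::finite mpoly \<Rightarrow> complex poly" where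
  "restrict_curve c p = (\<Sum>m\<in>Poly_Mapping.keys p.
     smult (Poly_Mapping.lookup p m) (\<Prod>i\<in>UNIV. c i ^ Poly_Mapping.lookup m i))"

lemma poly_restrict_curve: "poly (restrict_curve c p) t = eval_mpoly p (\<chi> i. poly (c i) t)"
  by (simp add: restrict_curve_def eval_mpoly_def monom_at_def poly_sum poly_prod)

text \<open>
  Join a point where \<open>p\<close> is nonzero to one where \<open>q\<close> is nonzero by a complex line: both restrictions to
  the line are nonzero univariate polynomials, so their product is nonzero as well.
\<close>

lemma mpoly_mult_eq_0_iff [simp]:
  fixes p q :: "'n::finite mpoly"
  shows "p * q = 0 \<longleftrightarrow> p = 0 \<or> q = 0"
proof
  assume pq: "p * q = 0"
  show "p = 0 \<or> q = 0"
  proof (rule ccontr)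
    assume "\<not> (p = 0 \<or> q = 0)"
    then obtain a b where a: "eval_mpoly p a \<noteq> 0" and b: "eval_mpoly q b \<noteq> 0"
      using mpoly_eqI[of p 0] mpoly_eqI[of q 0] by auto
    define c where "c i = [:a $ i, b $ i - a $ i:]" for i
    have *: "(\<chi> i. poly (c i) 0) = a" "(\<chi> i. poly (c i) 1) = b"
      by (auto simp: c_def vec_eq_iff)
    have "poly (restrict_curve c p) 0 \<noteq> 0" "poly (restrict_curve c q) 1 \<noteq> 0"
      using a b by (simp_all add: poly_restrict_curve *)
    then have "restrict_curve c p * restrict_curve c q \<noteq> 0" by auto
    moreover have "poly (restrict_curve c p * restrict_curve c q) t = 0" for t
      using arg_cong[OF pq, of "\<lambda>r. eval_mpoly r (\<chi> i. poly (c i) t)"]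
      by (simp add: poly_restrict_curve eval_mpoly_mult)
    ultimately show False using poly_all_0_iff_0 by blast
  qed
qed auto

lemma mpoly_mult_cancel_left:
  fixes p q r :: "'n::finite mpoly"
  assumes "p * q = p * r" "p \<noteq> 0"
  shows "q = r"
proof -
  have "p * (q - r) = 0" using assms(1) by (simp add: right_diff_distrib)
  then show ?thesis using assms(2) by simp
qed

lemma mpoly_power_eq_0D: "p ^ k = 0 \<Longrightarrow> (p :: 'n::finite mpoly) = 0"
  by (induction k) auto

section \<open>Polynomials in one distinguished variable\<close>

definition var :: "'n::finite \<Rightarrow> 'n mpoly" where
  "var i = Poly_Mapping.single (Poly_Mapping.single i 1) 1"

lemma var_power: "var i ^ k = Poly_Mapping.single (Poly_Mapping.single i k) 1"
  by (induction k) (auto simp: var_def mult_single single_add[symmetric])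

lemma eval_var [simp]: "eval_mpoly (var i) z = z $ i"
proof -
  have "(\<Prod>j\<in>UNIV. z $ j ^ Poly_Mapping.lookup (Poly_Mapping.single i 1) j)
      = (\<Prod>j\<in>UNIV. if j = i then z $ j else 1)"
    by (rule prod.cong) (auto simp: lookup_single when_def)
  then show ?thesis
    by (simp add: var_def eval_mpoly_single monom_at_def)
qed

definition vars :: "'n::finite mpoly \<Rightarrow> 'n set" where
  "vars p = (\<Union>m\<in>Poly_Mapping.keys p. Poly_Mapping.keys m)"

text \<open>
  The polynomial \<open>p\<close> as a univariate polynomial in the variable \<open>i\<close>, whose coefficients are
  polynomials in the remaining variables but keep their type.
\<close>

definition as_poly_in :: "'n::finite \<Rightarrow> 'n mpoly \<Rightarrow> 'n mpoly poly" where
  "as_poly_in i p = (\<Sum>m\<in>Poly_Mapping.keys p.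
     monom (Poly_Mapping.single (Poly_Mapping.update i 0 m) (Poly_Mapping.lookup p m)) (Poly_Mapping.lookup m i))"

lemma coeff_as_poly_in: "coeff (as_poly_in i p) k = (\<Sum>m\<in>Poly_Mapping.keys p.
   if Poly_Mapping.lookup m i = k
   then Poly_Mapping.single (Poly_Mapping.update i 0 m) (Poly_Mapping.lookup p m) else 0)"
  by (simp add: as_poly_in_def coeff_sum)

lemma update_add_single: "Poly_Mapping.update i 0 m + Poly_Mapping.single i (Poly_Mapping.lookup m i) = (m :: 'n \<Rightarrow>\<^sub>0 nat)"
  by (rule poly_mapping_eqI) (auto simp: lookup_add lookup_update lookup_single when_def)

lemma poly_as_poly_in [simp]: "poly (as_poly_in i p) (var i) = p"
proof -
  have "poly (as_poly_in i p) (var i) = (\<Sum>m\<in>Poly_Mapping.keys p. Poly_Mapping.single m (Poly_Mapping.lookup p m))"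
    by (simp add: as_poly_in_def poly_sum poly_monom var_power mult_single update_add_single)
  then show ?thesis using poly_mapping_sum_single[of p] by simp
qed

lemma vars_eval_cong:
  assumes "\<And>j. j \<in> vars p \<Longrightarrow> z $ j = w $ j"
  shows "eval_mpoly p z = eval_mpoly p w"
proof -
  have "monom_at z m = monom_at w m" if m: "m \<in> Poly_Mapping.keys p" for m
    unfolding monom_at_def
  proof (rule prod.cong)
    fix j
    show "z $ j ^ Poly_Mapping.lookup m j = w $ j ^ Poly_Mapping.lookup m j"
    proof (cases "j \<in> Poly_Mapping.keys m")
      case True
      then have "j \<in> vars p" using m by (auto simp: vars_def)
      then show ?thesis using assms by simp
    qed (simp add: in_keys_iff)
  qed simp
  then show ?thesis by (simp add: eval_mpoly_def)
qed

lemma vars_0 [simp]: "vars 0 = {}" by (simp add: vars_def)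
lemma vars_1 [simp]: "vars 1 = {}" by (simp add: vars_def)
lemma vars_const [simp]: "vars (const_mpoly c) = {}" by (simp add: vars_def const_mpoly_def)
lemma vars_var: "vars (var i) \<subseteq> {i}" by (auto simp: vars_def var_def split: if_splits)

lemma vars_add: "vars (p + q) \<subseteq> vars p \<union> vars q"
  using Poly_Mapping.keys_add[of p q] by (auto simp: vars_def)

lemma keys_add_nat: "Poly_Mapping.keys (m + m' :: 'n \<Rightarrow>\<^sub>0 nat) = Poly_Mapping.keys m \<union> Poly_Mapping.keys m'"
  by (auto simp: in_keys_iff lookup_add)

lemma vars_mult: "vars (p * q) \<subseteq> vars p \<union> vars q"
  using Poly_Mapping.keys_mult[of p q] by (fastforce simp: vars_def keys_add_nat)

lemma vars_uminus [simp]: "vars (- p) = vars p"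
  by (auto simp: vars_def in_keys_iff)

lemma vars_diff: "vars (p - q) \<subseteq> vars p \<union> vars q"
  using vars_add[of p "- q"] by simp

lemma vars_sum: "(\<And>x. x \<in> A \<Longrightarrow> vars (f x) \<subseteq> V) \<Longrightarrow> vars (sum f A) \<subseteq> V"
proof (induction A rule: infinite_finite_induct)
  case (insert x A)
  have "vars (f x) \<subseteq> V" "vars (sum f A) \<subseteq> V" using insert by auto
  then show ?case using insert.hyps vars_add[of "f x" "sum f A"] by (simp add: subset_trans)
qed auto

lemma vars_power: "vars (p ^ k) \<subseteq> vars p"
proof (induction k)
  case (Suc k)
  then show ?case using vars_mult[of p "p ^ k"] by auto
qed simp

lemma vars_coeff_as_poly_in: "vars (coeff (as_poly_in i p) k) \<subseteq> vars p - {i}"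
  unfolding coeff_as_poly_in
proof (rule vars_sum)
  fix m assume "m \<in> Poly_Mapping.keys p"
  then show "vars (if Poly_Mapping.lookup m i = k then Poly_Mapping.single (Poly_Mapping.update i 0 m) (Poly_Mapping.lookup p m) else 0)
      \<subseteq> vars p - {i}"
    by (auto simp: vars_def keys_update split: if_splits)
qed

lemma eval_poly: "eval_mpoly (poly P q) z = poly (map_poly (\<lambda>c. eval_mpoly c z) P) (eval_mpoly q z)"
  by (induction P) (auto simp: map_poly_pCons eval_mpoly_add eval_mpoly_mult)

text \<open>
  Fix all coordinates but the one of \<open>i\<close>: two representations give the same univariate complex polynomial
  function, hence the same values of the coefficients. This makes \<open>as_poly_in i\<close> a ring homomorphism.
\<close>

lemma as_poly_in_unique:
  assumes "poly P (var i) = p" and "\<And>k. i \<notin> vars (coeff P k)"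
  shows "as_poly_in i p = P"
proof -
  have "eval_mpoly (coeff (as_poly_in i p) k - coeff P k) z = 0" for k z
  proof -
    define h where "h = (\<lambda>P. map_poly (\<lambda>c :: 'a mpoly. eval_mpoly c z) P)"
    have *: "eval_mpoly p (set_coord z i t) = poly (h Q) t"
      if Q: "poly Q (var i) = p" "\<And>k. i \<notin> vars (coeff Q k)" for Q t
    proof -
      have "map_poly (\<lambda>c. eval_mpoly c (set_coord z i t)) Q = h Q"
        unfolding h_def
      proof (rule poly_eqI)
        fix n
        have "eval_mpoly (coeff Q n) (set_coord z i t) = eval_mpoly (coeff Q n) z"
          by (rule vars_eval_cong) (use Q(2) in \<open>auto simp: set_coord_nth\<close>)
        then show "coeff (map_poly (\<lambda>c. eval_mpoly c (set_coord z i t)) Q) n = coeff (map_poly (\<lambda>c. eval_mpoly c z) Q) n"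
          by (simp add: coeff_map_poly)
      qed
      then show ?thesis using Q(1) eval_poly[of Q "var i" "set_coord z i t"]
        by (simp add: set_coord_nth)
    qed
    have "poly (h (as_poly_in i p)) t = poly (h P) t" for t
      using *[of P t, OF assms] *[of "as_poly_in i p" t] vars_coeff_as_poly_in[of i p] by (metis Diff_iff insertI1 poly_as_poly_in subsetD)
    then have "h (as_poly_in i p) = h P" by (simp add: poly_eq_poly_eq_iff[symmetric] fun_eq_iff)
    then have "coeff (h (as_poly_in i p)) k = coeff (h P) k" by simp
    then show ?thesis by (simp add: h_def coeff_map_poly eval_mpoly_diff)
  qed
  then have "coeff (as_poly_in i p) k - coeff P k = 0" for k
    by (intro mpoly_eqI) auto
  then show ?thesis by (intro poly_eqI) auto
qed

lemma notin_vars_coeff_as_poly_in: "i \<notin> vars (coeff (as_poly_in i p) k)"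
  using vars_coeff_as_poly_in[of i p k] by auto

lemma as_poly_in_diff: "as_poly_in i (p - q) = as_poly_in i p - as_poly_in i q"
proof (rule as_poly_in_unique)
  show "i \<notin> vars (coeff (as_poly_in i p - as_poly_in i q) k)" for k
    using vars_diff[of "coeff (as_poly_in i p) k" "coeff (as_poly_in i q) k"]
      notin_vars_coeff_as_poly_in[of i p k] notin_vars_coeff_as_poly_in[of i q k] by auto
qed simp

lemma as_poly_in_mult: "as_poly_in i (p * q) = as_poly_in i p * as_poly_in i q"
proof (rule as_poly_in_unique)
  fix k
  have "vars (coeff (as_poly_in i p * as_poly_in i q) k) \<subseteq> - {i}"
    unfolding coeff_mult
  proof (rule vars_sum)
    fix x
    show "vars (coeff (as_poly_in i p) x * coeff (as_poly_in i q) (k - x)) \<subseteq> - {i}"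
      using vars_mult[of "coeff (as_poly_in i p) x" "coeff (as_poly_in i q) (k - x)"]
        notin_vars_coeff_as_poly_in[of i p x] notin_vars_coeff_as_poly_in[of i q "k - x"] by blast
  qed
  then show "i \<notin> vars (coeff (as_poly_in i p * as_poly_in i q) k)" by blast
qed simp

lemma as_poly_in_const: "i \<notin> vars p \<Longrightarrow> as_poly_in i p = [:p:]"
  by (rule as_poly_in_unique) (auto simp: coeff_pCons split: nat.splits)

lemma as_poly_in_0 [simp]: "as_poly_in i 0 = 0"
  by (simp add: as_poly_in_def)

lemma as_poly_in_eq_0_iff [simp]: "as_poly_in i p = 0 \<longleftrightarrow> p = 0"
  using poly_as_poly_in[of i p] by (auto simp del: poly_as_poly_in)

lemma as_poly_in_var_power: "as_poly_in i (var i ^ k) = monom 1 k"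
  by (rule as_poly_in_unique) (auto simp: poly_monom)

definition degree_in :: "'n::finite \<Rightarrow> 'n mpoly \<Rightarrow> nat" where
  "degree_in i p = degree (as_poly_in i p)"

definition leading_coeff_in :: "'n::finite \<Rightarrow> 'n mpoly \<Rightarrow> 'n mpoly" where
  "leading_coeff_in i p = coeff (as_poly_in i p) (degree_in i p)"

lemma leading_coeff_in_eq_0_iff [simp]: "leading_coeff_in i p = 0 \<longleftrightarrow> p = 0"
  by (simp add: leading_coeff_in_def degree_in_def)

lemma vars_leading_coeff_in: "vars (leading_coeff_in i p) \<subseteq> vars p - {i}"
  by (simp add: leading_coeff_in_def vars_coeff_as_poly_in)

lemma degree_in_mult:
  assumes "p \<noteq> 0" "q \<noteq> 0"
  shows "degree_in i (p * q) = degree_in i p + degree_in i q"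
proof -
  have "coeff (as_poly_in i (p * q)) (degree_in i p + degree_in i q) = leading_coeff_in i p * leading_coeff_in i q"
    by (simp add: as_poly_in_mult coeff_mult_degree_sum degree_in_def leading_coeff_in_def)
  then have "degree_in i p + degree_in i q \<le> degree_in i (p * q)"
    unfolding degree_in_def[of i "p * q"] using assms by (intro le_degree) auto
  moreover have "degree_in i (p * q) \<le> degree_in i p + degree_in i q"
    by (simp add: degree_in_def as_poly_in_mult degree_mult_le)
  ultimately show ?thesis by simp
qed

text \<open>
  This turns the multidegree, a maximum over exponents, into degrees of univariate
  polynomials, for which additivity under products is available.
\<close>

lemma lookup_multidegree_eq_degree_in: "Poly_Mapping.lookup (multidegree p) i = degree_in i p"
proof (cases "p = 0")
  case True
  then show ?thesis by (simp add: lookup_multidegree degree_in_def)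
next
  case False
  define D where "D = Poly_Mapping.lookup (multidegree p) i"
  have "D \<in> insert 0 ((\<lambda>m. Poly_Mapping.lookup m i) ` Poly_Mapping.keys p)"
    unfolding D_def lookup_multidegree by (rule Max_in) auto
  moreover have "\<exists>m\<in>Poly_Mapping.keys p. Poly_Mapping.lookup m i = D" if "D = 0"
  proof -
    obtain m where "m \<in> Poly_Mapping.keys p" using False keys_eq_empty by blast
    then show ?thesis using lookup_le_multidegree[of m p i] that by (auto simp: D_def)
  qed
  ultimately obtain m where m: "m \<in> Poly_Mapping.keys p" "Poly_Mapping.lookup m i = D" by auto
  have "Poly_Mapping.lookup (coeff (as_poly_in i p) D) (Poly_Mapping.update i 0 m)
     = (\<Sum>k\<in>Poly_Mapping.keys p. if k = m then Poly_Mapping.lookup p m else 0)"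
    unfolding coeff_as_poly_in lookup_sum
  proof (rule sum.cong)
    fix k
    have "k = m" if "Poly_Mapping.lookup k i = D" "Poly_Mapping.update i 0 k = Poly_Mapping.update i 0 m"
      using update_add_single[of i k] update_add_single[of i m] that m(2) by metis
    then show "Poly_Mapping.lookup (if Poly_Mapping.lookup k i = D then
         Poly_Mapping.single (Poly_Mapping.update i 0 k) (Poly_Mapping.lookup p k) else 0) (Poly_Mapping.update i 0 m)
       = (if k = m then Poly_Mapping.lookup p m else 0)"
      using m(2) by (auto simp: lookup_single when_def)
  qed simp
  also have "\<dots> \<noteq> 0" using m(1) by (simp add: in_keys_iff)
  finally have "coeff (as_poly_in i p) D \<noteq> 0" by auto
  then have "D \<le> degree_in i p" unfolding degree_in_def by (rule le_degree)
  moreover have "degree_in i p \<le> D"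
    unfolding degree_in_def
  proof (rule degree_le, intro allI impI)
    fix k assume k: "D < k"
    have "Poly_Mapping.lookup m i \<noteq> k" if "m \<in> Poly_Mapping.keys p" for m
      using lookup_le_multidegree[OF that, of i] k by (auto simp: D_def)
    then show "coeff (as_poly_in i p) k = 0" unfolding coeff_as_poly_in by (intro sum.neutral) auto
  qed
  ultimately show ?thesis by (simp add: D_def)
qed

lemma multidegree_mult:
  assumes "p \<noteq> 0" "q \<noteq> 0"
  shows "multidegree (p * q) = multidegree p + multidegree q"
  by (rule poly_mapping_eqI) (simp add: lookup_add lookup_multidegree_eq_degree_in degree_in_mult assms)

lemma in_vars_iff_degree_in: "i \<in> vars p \<longleftrightarrow> degree_in i p > 0"
proof
  assume "i \<in> vars p"
  then obtain m where m: "m \<in> Poly_Mapping.keys p" "i \<in> Poly_Mapping.keys m" by (auto simp: vars_def)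
  then show "degree_in i p > 0" using lookup_le_multidegree[OF m(1), of i]
    by (auto simp: in_keys_iff lookup_multidegree_eq_degree_in)
next
  assume d: "degree_in i p > 0"
  show "i \<in> vars p"
  proof (rule ccontr)
    assume "i \<notin> vars p"
    then show False using d by (simp add: degree_in_def as_poly_in_const)
  qed
qed

lemma vars_mult_eq: "p \<noteq> 0 \<Longrightarrow> q \<noteq> 0 \<Longrightarrow> vars (p * q) = vars p \<union> vars q"
  by (auto simp: in_vars_iff_degree_in degree_in_mult)

lemma vars_empty_iff: "vars p = {} \<longleftrightarrow> (\<exists>c. p = const_mpoly c)"
proof
  assume *: "vars p = {}"
  have "p = const_mpoly (eval_mpoly p 0)"
    by (rule mpoly_eqI) (use * in \<open>auto intro: vars_eval_cong\<close>)
  then show "\<exists>c. p = const_mpoly c" by blast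
qed auto

lemma const_mpoly_mult: "const_mpoly c * const_mpoly d = const_mpoly (c * d)"
  by (simp add: const_mpoly_def mult_single)

lemma const_mpoly_eq_0_iff [simp]: "const_mpoly c = 0 \<longleftrightarrow> c = 0"
  by (metis const_mpoly_0 eval_mpoly_const eval_mpoly_0)

lemma unit_iff: "p dvd (1 :: 'n::finite mpoly) \<longleftrightarrow> (\<exists>c. c \<noteq> 0 \<and> p = const_mpoly c)"
proof
  assume "p dvd 1"
  then obtain q where q: "1 = p * q" by (auto simp: dvd_def)
  then have "p \<noteq> 0" "q \<noteq> 0" by auto
  then have "vars p \<union> vars q = {}" using vars_mult_eq[of p q] q by simp
  then show "\<exists>c. c \<noteq> 0 \<and> p = const_mpoly c" using vars_empty_iff[of p] \<open>p \<noteq> 0\<close> by auto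
next
  assume "\<exists>c. c \<noteq> 0 \<and> p = const_mpoly c"
  then obtain c where "c \<noteq> 0" "p = const_mpoly c" by auto
  then have "1 = p * const_mpoly (1 / c)" by (simp add: const_mpoly_mult)
  then show "p dvd 1" by (rule dvdI)
qed

lemma unit_iff_vars: "p \<noteq> 0 \<Longrightarrow> p dvd (1 :: 'n::finite mpoly) \<longleftrightarrow> vars p = {}"
  unfolding unit_iff vars_empty_iff by auto

text \<open>
  Used only as a measure for induction: it is additive and vanishes exactly on the nonzero constants.
\<close>

definition degree_sum :: "'n::finite mpoly \<Rightarrow> nat" where
  "degree_sum p = (\<Sum>i\<in>UNIV. degree_in i p)"

lemma degree_sum_mult: "p \<noteq> 0 \<Longrightarrow> q \<noteq> 0 \<Longrightarrow> degree_sum (p * q) = degree_sum p + degree_sum q"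
  by (simp add: degree_sum_def degree_in_mult sum.distrib)

lemma unit_iff_degree_sum: "p \<noteq> 0 \<Longrightarrow> p dvd 1 \<longleftrightarrow> degree_sum p = 0"
  using in_vars_iff_degree_in[of _ p] by (auto simp: unit_iff_vars degree_sum_def)

lemma irreducible_degree_sum_pos: "irreducible (r :: 'n::finite mpoly) \<Longrightarrow> degree_sum r > 0"
  using unit_iff_degree_sum[of r] by (auto simp: irreducible_def)

lemma irreducible_factor:
  fixes p :: "'n::finite mpoly"
  assumes "p \<noteq> 0" "\<not> p dvd 1"
  obtains r s where "irreducible r" "p = r * s"
proof -
  have "\<exists>r s. irreducible r \<and> p = r * s"
    using assms
  proof (induction "degree_sum p" arbitrary: p rule: less_induct)
    case less
    show ?case
    proof (cases "irreducible p")
      case True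
      then show ?thesis by (intro exI[of _ p] exI[of _ 1]) auto
    next
      case False
      then obtain a b where ab: "p = a * b" "\<not> a dvd 1" "\<not> b dvd 1"
        using less.prems by (auto simp: irreducible_def)
      then have "a \<noteq> 0" "b \<noteq> 0" using less.prems by auto
      then have "degree_sum a < degree_sum p" using ab unit_iff_degree_sum[of b] by (simp add: degree_sum_mult)
      then obtain r s where "irreducible r" "a = r * s" using less.hyps \<open>a \<noteq> 0\<close> ab by blast
      then show ?thesis using ab by (intro exI[of _ r] exI[of _ "s * b"]) (auto simp: mult_ac)
    qed
  qed
  then show ?thesis using that by blast
qed

lemma factor_induct [consumes 1, case_names unit factor]:
  fixes p :: "'n::finite mpoly"
  assumes "p \<noteq> 0"
    and "\<And>c. c \<noteq> 0 \<Longrightarrow> P (const_mpoly c)"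
    and "\<And>r p. irreducible r \<Longrightarrow> p \<noteq> 0 \<Longrightarrow> P p \<Longrightarrow> P (r * p)"
  shows "P p"
  using assms(1)
proof (induction "degree_sum p" arbitrary: p rule: less_induct)
  case less
  show ?case
  proof (cases "p dvd 1")
    case True
    then show ?thesis using assms(2) by (auto simp: unit_iff)
  next
    case False
    then obtain r s where rs: "irreducible r" "p = r * s" using irreducible_factor less.prems by metis
    then have "s \<noteq> 0" "r \<noteq> 0" using less.prems by auto
    moreover have "degree_sum s < degree_sum p"
      using irreducible_degree_sum_pos[OF rs(1)] \<open>s \<noteq> 0\<close> \<open>r \<noteq> 0\<close> by (simp add: rs degree_sum_mult)
    ultimately show ?thesis using less.hyps rs assms(3) by blast
  qed
qed

section \<open>Prime factors and the Nullstellensatz for hypersurfaces\<close>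

text \<open>
  Primality relative to the subring of polynomials in the variables \<open>V\<close>, a formulation that allows induction
  on \<open>V\<close>. Irreducibility can be absolute here, since the factors of a nonzero polynomial in
  the variables \<open>V\<close> only involve these variables.
\<close>

definition irreducibles_prime_in :: "'n::finite set \<Rightarrow> bool" where
  "irreducibles_prime_in V \<longleftrightarrow> (\<forall>r f g :: 'n mpoly. irreducible r \<longrightarrow> vars r \<subseteq> V \<longrightarrow> vars f \<subseteq> V \<longrightarrow> vars g \<subseteq> V \<longrightarrow>
     r dvd f * g \<longrightarrow> r dvd f \<or> r dvd g)"

lemma dvd_iff_dvd_coeff_as_poly_in:
  assumes "i \<notin> vars l"
  shows "l dvd f \<longleftrightarrow> (\<forall>k. l dvd coeff (as_poly_in i f) k)"
proof
  assume "l dvd f"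
  then obtain q where "f = l * q" by (auto simp: dvd_def)
  then have "as_poly_in i f = smult l (as_poly_in i q)" using assms by (simp add: as_poly_in_mult as_poly_in_const)
  then show "\<forall>k. l dvd coeff (as_poly_in i f) k" by simp
next
  assume *: "\<forall>k. l dvd coeff (as_poly_in i f) k"
  have "f = (\<Sum>k\<le>degree (as_poly_in i f). coeff (as_poly_in i f) k * var i ^ k)"
    using poly_as_poly_in[of i f] by (simp add: poly_altdef del: poly_as_poly_in)
  moreover have "l dvd (\<Sum>k\<le>degree (as_poly_in i f). coeff (as_poly_in i f) k * var i ^ k)"
    using * by (intro dvd_sum) auto
  ultimately show "l dvd f" by simp
qed

text \<open>
  Gauss's argument: if \<open>l\<close> divides neither factor, take in each the first coefficient not divisible
  by \<open>l\<close>; in the product of \<open>f\<close> and \<open>g\<close>, the coefficient at the sum of these two places is not divisible by \<open>l\<close>.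
\<close>

lemma gauss_lemma:
  fixes l f g :: "'n::finite mpoly"
  assumes V: "irreducibles_prime_in V" "i \<notin> V" and l: "irreducible l" "vars l \<subseteq> V"
    and fg: "vars f \<subseteq> insert i V" "vars g \<subseteq> insert i V" "l dvd f * g"
  shows "l dvd f \<or> l dvd g"
proof (rule ccontr)
  assume neg: "\<not> (l dvd f \<or> l dvd g)"
  have il: "i \<notin> vars l" using l V by auto
  have ex: "\<exists>k. \<not> l dvd coeff (as_poly_in i f) k" "\<exists>k. \<not> l dvd coeff (as_poly_in i g) k"
    using neg dvd_iff_dvd_coeff_as_poly_in[OF il] by blast+
  define a where "a = (LEAST k. \<not> l dvd coeff (as_poly_in i f) k)"
  define b where "b = (LEAST k. \<not> l dvd coeff (as_poly_in i g) k)"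
  have a: "\<not> l dvd coeff (as_poly_in i f) a" "\<And>k. k < a \<Longrightarrow> l dvd coeff (as_poly_in i f) k"
    using LeastI_ex[OF ex(1)] not_less_Least unfolding a_def by blast+
  have b: "\<not> l dvd coeff (as_poly_in i g) b" "\<And>k. k < b \<Longrightarrow> l dvd coeff (as_poly_in i g) k"
    using LeastI_ex[OF ex(2)] not_less_Least unfolding b_def by blast+
  define h where "h k = coeff (as_poly_in i f) k * coeff (as_poly_in i g) (a + b - k)" for k
  have "(\<Sum>k\<le>a + b. h k) = h a + (\<Sum>k\<in>{..a + b} - {a}. h k)"
    by (subst sum.remove[of _ a]) auto
  moreover have "l dvd (\<Sum>k\<le>a + b. h k)"
    using fg(3) dvd_iff_dvd_coeff_as_poly_in[OF il, of "f * g"] by (simp add: as_poly_in_mult coeff_mult h_def)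
  moreover have "l dvd (\<Sum>k\<in>{..a + b} - {a}. h k)"
  proof (rule dvd_sum)
    fix k assume "k \<in> {..a + b} - {a}"
    then have "k < a \<or> a + b - k < b" by auto
    then show "l dvd h k" unfolding h_def using a(2) b(2) by (metis dvd_mult dvd_mult2)
  qed
  ultimately have "l dvd h a" by (metis dvd_add_left_iff)
  then have "l dvd coeff (as_poly_in i f) a * coeff (as_poly_in i g) b" by (simp add: h_def)
  moreover have "vars (coeff (as_poly_in i f) a) \<subseteq> V" "vars (coeff (as_poly_in i g) b) \<subseteq> V"
    using vars_coeff_as_poly_in[of i f a] vars_coeff_as_poly_in[of i g b] fg by auto
  ultimately show False using V(1) l a b unfolding irreducibles_prime_in_def by blast
qed

text \<open>
  A factor \<open>c\<close> without the variable \<open>i\<close> can be split off from a factorization: each irreducible factor of \<open>c\<close>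
  divides \<open>e\<close> or \<open>v\<close> by Gauss's lemma and is cancelled there.
\<close>

lemma strip_content:
  fixes c r e v :: "'n::finite mpoly"
  assumes V: "irreducibles_prime_in V" "i \<notin> V" and "c \<noteq> 0" "vars c \<subseteq> V"
    and "c * r = e * v" "vars e \<subseteq> insert i V" "vars v \<subseteq> insert i V" "e \<noteq> 0" "v \<noteq> 0"
  shows "\<exists>c1 c2 e' v'. vars c1 \<subseteq> V \<and> vars c2 \<subseteq> V \<and> e = c1 * e' \<and> v = c2 * v' \<and> r = e' * v'"
  using assms(3-)
proof (induction c arbitrary: e v rule: factor_induct)
  case (unit c)
  have eq: "const_mpoly (1 / c) * const_mpoly c = 1" using unit by (simp add: const_mpoly_mult)
  have "r = (const_mpoly (1 / c) * const_mpoly c) * r" by (simp add: eq)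
  also have "\<dots> = const_mpoly (1 / c) * (const_mpoly c * r)" by (simp add: mult.assoc)
  also have "\<dots> = const_mpoly (1 / c) * e * v" by (simp add: unit mult.assoc)
  finally have r: "r = const_mpoly (1 / c) * e * v" .
  have "e = (const_mpoly (1 / c) * const_mpoly c) * e" by (simp add: eq)
  then have "e = const_mpoly c * (const_mpoly (1 / c) * e)" by (simp add: mult_ac)
  then show ?case using r
    by (intro exI[of _ "const_mpoly c"] exI[of _ 1] exI[of _ "const_mpoly (1 / c) * e"] exI[of _ v]) auto
next
  case (factor l c)
  have "l \<noteq> 0" using factor.hyps by auto
  have lc: "vars l \<subseteq> V" "vars c \<subseteq> V"
    using factor.prems(1) vars_mult_eq[OF \<open>l \<noteq> 0\<close> \<open>c \<noteq> 0\<close>] by auto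
  have "l dvd e * v" using factor.prems(2) by (metis dvd_def mult.assoc)
  then have "l dvd e \<or> l dvd v"
    using gauss_lemma[OF V factor.hyps(1) lc(1)] factor.prems by blast
  then show ?case
  proof
    assume "l dvd e"
    then obtain e1 where e1: "e = l * e1" by (auto simp: dvd_def)
    have "l * (c * r) = l * (e1 * v)" using factor.prems(2) e1 by (simp add: mult_ac)
    then have "c * r = e1 * v" using mpoly_mult_cancel_left \<open>l \<noteq> 0\<close> by blast
    moreover have "e1 \<noteq> 0" using e1 factor.prems by auto
    moreover have "vars e1 \<subseteq> insert i V" using vars_mult_eq[OF \<open>l \<noteq> 0\<close> \<open>e1 \<noteq> 0\<close>] e1 factor.prems by auto
    ultimately obtain c1 c2 e' v' where *: "vars c1 \<subseteq> V" "vars c2 \<subseteq> V" "e1 = c1 * e'" "v = c2 * v'" "r = e' * v'"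
      using factor.IH[of e1 v] factor.prems lc by blast
    have "vars (l * c1) \<subseteq> V" using vars_mult[of l c1] lc * by auto
    then show ?thesis using * e1 by (metis mult.assoc)
  next
    assume "l dvd v"
    then obtain v1 where v1: "v = l * v1" by (auto simp: dvd_def)
    have "l * (c * r) = l * (e * v1)" using factor.prems(2) v1 by (simp add: mult_ac)
    then have "c * r = e * v1" using mpoly_mult_cancel_left \<open>l \<noteq> 0\<close> by blast
    moreover have "v1 \<noteq> 0" using v1 factor.prems by auto
    moreover have "vars v1 \<subseteq> insert i V" using vars_mult_eq[OF \<open>l \<noteq> 0\<close> \<open>v1 \<noteq> 0\<close>] v1 factor.prems by auto
    ultimately obtain c1 c2 e' v' where *: "vars c1 \<subseteq> V" "vars c2 \<subseteq> V" "e = c1 * e'" "v1 = c2 * v'" "r = e' * v'"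
      using factor.IH[of e v1] factor.prems lc by blast
    have "vars (l * c2) \<subseteq> V" using vars_mult[of l c2] lc * by auto
    then show ?thesis using * v1 by (metis mult.assoc)
  qed
qed

lemma irreducible_dvd_mult_coefficient:
  fixes c r f :: "'n::finite mpoly"
  assumes V: "irreducibles_prime_in V" "i \<notin> V" and c: "c \<noteq> 0" "vars c \<subseteq> V"
    and r: "irreducible r" "i \<in> vars r" "vars r \<subseteq> insert i V" and f: "vars f \<subseteq> insert i V" "r dvd c * f"
  shows "r dvd f"
proof (cases "f = 0")
  case False
  obtain h where h: "c * f = r * h" using f by (auto simp: dvd_def)
  have nz: "r \<noteq> 0" "h \<noteq> 0" using r h False c by auto
  have "vars (c * f) \<subseteq> insert i V" using vars_mult[of c f] c f by auto
  then have "vars h \<subseteq> insert i V" using h vars_mult_eq[OF nz] by auto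
  then obtain c1 c2 r' h' where *: "vars c1 \<subseteq> V" "vars c2 \<subseteq> V" "r = c1 * r'" "h = c2 * h'" "f = r' * h'"
    using strip_content[OF V c h r(3) _ nz] by blast
  have "c1 \<noteq> 0" "r' \<noteq> 0" using * nz by auto
  then have "i \<in> vars r'" using vars_mult_eq[of c1 r'] * r(2) V(2) by auto
  then have "\<not> r' dvd 1" using unit_iff_vars[OF \<open>r' \<noteq> 0\<close>] by auto
  then have "c1 dvd 1" using r(1) * by (auto simp: irreducible_def)
  then have "r dvd r'" using * by (metis dvd_refl mult_dvd_mono mult.left_neutral)
  then show ?thesis using * by (metis dvd_mult2)
qed simp

text \<open>
  Division with remainder with respect to the variable \<open>i\<close>, made possible without inverting the leading
  coefficient of \<open>e\<close> by multiplying the dividend with powers of it.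
\<close>

lemma pseudo_division:
  fixes e g :: "'n::finite mpoly"
  assumes "e \<noteq> 0" "vars e \<subseteq> insert i V" "vars g \<subseteq> insert i V"
  shows "\<exists>k q \<rho>. leading_coeff_in i e ^ k * g = q * e + \<rho> \<and> vars q \<subseteq> insert i V \<and> vars \<rho> \<subseteq> insert i V \<and>
    (\<rho> = 0 \<or> degree_in i \<rho> < degree_in i e)"
  using assms(3)
proof (induction "degree_in i g" arbitrary: g rule: less_induct)
  case less
  show ?case
  proof (cases "g = 0 \<or> degree_in i g < degree_in i e")
    case True
    then show ?thesis using less.prems by (intro exI[of _ 0] exI[of _ g]) auto
  next
    case False
    define t where "t = leading_coeff_in i g * var i ^ (degree_in i g - degree_in i e)"
    \<comment> \<open>the usual step of the division algorithm, which removes the leading term of \<open>g\<close>\<close>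
    define g1 where "g1 = leading_coeff_in i e * g - t * e"
    have vt: "vars t \<subseteq> insert i V"
      using vars_mult[of "leading_coeff_in i g" "var i ^ (degree_in i g - degree_in i e)"] vars_leading_coeff_in[of i g]
        vars_power[of "var i" "degree_in i g - degree_in i e"] vars_var[of i] less.prems unfolding t_def by blast
    have ve: "vars (leading_coeff_in i e) \<subseteq> insert i V" using vars_leading_coeff_in[of i e] assms by auto
    have v1: "vars g1 \<subseteq> insert i V"
      using vars_diff[of "leading_coeff_in i e * g" "t * e"] vars_mult[of t e] vars_mult[of "leading_coeff_in i e" g] vt ve assms less.prems
      unfolding g1_def by blast
    have ni: "i \<notin> vars (leading_coeff_in i e)" "i \<notin> vars (leading_coeff_in i g)" using vars_leading_coeff_in[of i e] vars_leading_coeff_in[of i g] by auto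
    have u: "as_poly_in i g1 = smult (leading_coeff_in i e) (as_poly_in i g) - smult (leading_coeff_in i g) (monom 1 (degree_in i g - degree_in i e) * as_poly_in i e)"
      by (simp add: g1_def t_def as_poly_in_diff as_poly_in_mult as_poly_in_const[OF ni(1)] as_poly_in_const[OF ni(2)] as_poly_in_var_power)
    have z: "coeff (as_poly_in i g1) k = 0" if k: "k \<ge> degree_in i g" for k
    proof (cases "k = degree_in i g")
      case True
      then show ?thesis using False by (simp add: u coeff_monom_mult leading_coeff_in_def)
    next
      case kk: False
      then have "coeff (as_poly_in i g) k = 0" "coeff (as_poly_in i e) (k - (degree_in i g - degree_in i e)) = 0"
        using k False by (auto simp: degree_in_def intro!: coeff_eq_0)
      then show ?thesis by (simp add: u coeff_monom_mult)
    qed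
    have "g1 = 0 \<or> degree_in i g1 < degree_in i g"
    proof (cases "g1 = 0")
      case False
      then have "coeff (as_poly_in i g1) (degree_in i g1) \<noteq> 0" by (simp add: degree_in_def)
      then show ?thesis using z[of "degree_in i g1"] by (meson not_le)
    qed simp
    then have "\<exists>k q \<rho>. leading_coeff_in i e ^ k * g1 = q * e + \<rho> \<and> vars q \<subseteq> insert i V \<and> vars \<rho> \<subseteq> insert i V \<and>
      (\<rho> = 0 \<or> degree_in i \<rho> < degree_in i e)"
    proof
      assume "g1 = 0"
      then show ?thesis by (intro exI[of _ 0]) auto
    qed (use less.hyps v1 in blast)
    then obtain k q \<rho> where *: "leading_coeff_in i e ^ k * g1 = q * e + \<rho>" "vars q \<subseteq> insert i V" "vars \<rho> \<subseteq> insert i V"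
      "\<rho> = 0 \<or> degree_in i \<rho> < degree_in i e" by blast
    have "leading_coeff_in i e ^ Suc k * g = leading_coeff_in i e ^ k * g1 + leading_coeff_in i e ^ k * t * e"
      by (simp add: g1_def algebra_simps)
    also have "\<dots> = (q + leading_coeff_in i e ^ k * t) * e + \<rho>" using * by (simp add: algebra_simps)
    finally have "leading_coeff_in i e ^ Suc k * g = (q + leading_coeff_in i e ^ k * t) * e + \<rho>" .
    moreover have "vars (q + leading_coeff_in i e ^ k * t) \<subseteq> insert i V"
      using vars_add[of q "leading_coeff_in i e ^ k * t"] vars_mult[of "leading_coeff_in i e ^ k" t] vars_power[of "leading_coeff_in i e" k] *(2) vt ve by blast
    ultimately show ?thesis using * by blast
  qed
qed

text \<open>
  Elimination of the variable \<open>i\<close> from \<open>f\<close> and \<open>r\<close>. Take an element \<open>e\<close> of the ideal of \<open>f\<close> and \<open>r\<close> of minimal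
  degree in \<open>i\<close>. Up to factors without \<open>i\<close> it divides both \<open>f\<close> and \<open>r\<close>; as \<open>r\<close> is irreducible and does not
  divide \<open>f\<close>, this leaves only an \<open>e\<close> that does not involve \<open>i\<close>.
\<close>

lemma bezout_eliminant:
  fixes r f :: "'n::finite mpoly"
  assumes V: "irreducibles_prime_in V" "i \<notin> V"
    and r: "irreducible r" "i \<in> vars r" "vars r \<subseteq> insert i V" and f: "vars f \<subseteq> insert i V" "\<not> r dvd f"
  shows "\<exists>\<alpha> \<beta> c. c \<noteq> 0 \<and> vars c \<subseteq> V \<and> c = \<alpha> * f + \<beta> * r"
proof -
  define J where "J e \<longleftrightarrow> e \<noteq> 0 \<and> vars e \<subseteq> insert i V \<and> (\<exists>\<alpha> \<beta>. e = \<alpha> * f + \<beta> * r)" for e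
  have "r = 0 * f + 1 * r" by simp
  then have "J r" using r unfolding J_def by (metis irreducible_def)
  then obtain e where e: "J e" and min: "\<And>x. J x \<Longrightarrow> degree_in i e \<le> degree_in i x"
    using ex_has_least_nat[of J r "degree_in i"] by blast
  then obtain \<alpha> \<beta> where e': "e \<noteq> 0" "vars e \<subseteq> insert i V" "e = \<alpha> * f + \<beta> * r" by (auto simp: J_def)
  \<comment> \<open>by minimality of its degree, \<open>e\<close> divides every element of the ideal after multiplication with a power
    of its leading coefficient\<close>
  have div: "\<exists>k q. leading_coeff_in i e ^ k * g = q * e \<and> vars q \<subseteq> insert i V"
    if g: "vars g \<subseteq> insert i V" "g = \<alpha>' * f + \<beta>' * r" for g \<alpha>' \<beta>'
  proof -
    obtain k q \<rho> where *: "leading_coeff_in i e ^ k * g = q * e + \<rho>" "vars q \<subseteq> insert i V" "vars \<rho> \<subseteq> insert i V"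
      "\<rho> = 0 \<or> degree_in i \<rho> < degree_in i e" using pseudo_division[OF e'(1,2) g(1)] by blast
    have "\<rho> = leading_coeff_in i e ^ k * g - q * e" using *(1) by simp
    also have "\<dots> = (leading_coeff_in i e ^ k * \<alpha>' - q * \<alpha>) * f + (leading_coeff_in i e ^ k * \<beta>' - q * \<beta>) * r"
      unfolding g(2) e'(3) by (simp add: algebra_simps)
    finally have "\<rho> = 0 \<or> J \<rho>" using * unfolding J_def by blast
    then have "\<rho> = 0" using min[of \<rho>] * by auto
    then show ?thesis using * by auto
  qed
  obtain k q where q: "leading_coeff_in i e ^ k * r = q * e" "vars q \<subseteq> insert i V"
    using div[of r 0 1] r by auto
  obtain k' q' where q': "leading_coeff_in i e ^ k' * f = q' * e"
    using div[of f 1 0] f by auto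
  have vl: "vars (leading_coeff_in i e ^ k) \<subseteq> V" for k using vars_power[of "leading_coeff_in i e" k] vars_leading_coeff_in[of i e] e' by auto
  have l0: "leading_coeff_in i e ^ k \<noteq> 0" for k using mpoly_power_eq_0D[of "leading_coeff_in i e" k] e'(1) by auto
  have "q \<noteq> 0" using q l0[of k] r by auto
  have "leading_coeff_in i e ^ k * r = e * q" using q by (simp add: mult.commute)
  then obtain c1 c2 e1 v where *: "vars c1 \<subseteq> V" "vars c2 \<subseteq> V" "e = c1 * e1" "q = c2 * v" "r = e1 * v"
    using strip_content[OF V l0 vl _ e'(2) q(2) e'(1) \<open>q \<noteq> 0\<close>] by blast
  have "e1 dvd 1 \<or> v dvd 1" using r(1) * by (auto simp: irreducible_def)
  moreover have "\<not> v dvd 1"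
  proof
    assume "v dvd 1"
    then have "r dvd e1" using * by (metis dvd_refl mult_dvd_mono mult.right_neutral)
    then have "r dvd leading_coeff_in i e ^ k' * f" using * q' by (metis dvd_mult)
    then have "r dvd f" using irreducible_dvd_mult_coefficient[OF V l0 vl r f(1)] by blast
    then show False using f by simp
  qed
  ultimately have "e1 dvd 1" by blast
  moreover have "e1 \<noteq> 0" "c1 \<noteq> 0" using * e' by auto
  ultimately have "vars e \<subseteq> V" using unit_iff_vars[of e1] vars_mult_eq[of c1 e1] * by auto
  then show ?thesis using e' by blast
qed

lemma irreducibles_prime_in_insert:
  assumes V: "irreducibles_prime_in V" "i \<notin> V"
  shows "irreducibles_prime_in (insert i (V :: 'n::finite set))"
  unfolding irreducibles_prime_in_def
proof (intro allI impI)
  fix r f g :: "'n mpoly"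
  assume r: "irreducible r" "vars r \<subseteq> insert i V"
    and f: "vars f \<subseteq> insert i V" and g: "vars g \<subseteq> insert i V" and d: "r dvd f * g"
  show "r dvd f \<or> r dvd g"
  proof (cases "i \<in> vars r")
    case False
    then have "vars r \<subseteq> V" using r by auto
    then show ?thesis using gauss_lemma[OF V r(1) _ f g d] by blast
  next
    case True
    show ?thesis
    proof (cases "r dvd f")
      case False
      then obtain \<alpha> \<beta> c where c: "c \<noteq> 0" "vars c \<subseteq> V" "c = \<alpha> * f + \<beta> * r"
        using bezout_eliminant[OF V r(1) True r(2) f] by blast
      have "c * g = \<alpha> * (f * g) + r * (\<beta> * g)" using c by (simp add: algebra_simps)
      then have "r dvd c * g" using d by auto
      then show ?thesis using irreducible_dvd_mult_coefficient[OF V c(1,2) r(1) True r(2) g] by blast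
    qed simp
  qed
qed

lemma irreducibles_prime_in_any: "irreducibles_prime_in (V :: 'n::finite set)"
proof -
  have "finite V" by simp
  then show ?thesis
  proof (induction V rule: finite_induct)
    case empty
    have "r dvd 1" if "irreducible r" "vars r = {}" for r :: "'n mpoly"
      using that unit_iff_vars[of r] by (auto simp: irreducible_def)
    then show ?case unfolding irreducibles_prime_in_def by (auto simp: irreducible_def)
  next
    case (insert i V)
    then show ?case using irreducibles_prime_in_insert by blast
  qed
qed

theorem irreducible_mpoly_dvd_multD:
  fixes r f g :: "'n::finite mpoly"
  assumes "irreducible r" "r dvd f * g"
  shows "r dvd f \<or> r dvd g"
  using irreducibles_prime_in_any[of UNIV] assms unfolding irreducibles_prime_in_def by blast

text \<open>
  If \<open>r\<close> did not divide \<open>f\<close>, some nonzero \<open>c = \<alpha> f + \<beta> r\<close> without the variable \<open>i\<close> would vanish on the zero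
  set of \<open>r\<close>. But this zero set meets every line in direction \<open>i\<close> on which the leading coefficient of \<open>r\<close> is
  nonzero, by the fundamental theorem of algebra, so \<open>c\<close> times that coefficient would vanish everywhere.
\<close>

theorem irreducible_nullstellensatz:
  fixes r f :: "'n::finite mpoly"
  assumes r: "irreducible r" and zero: "\<And>z. z \<in> zero_set r \<Longrightarrow> eval_mpoly f z = 0"
  shows "r dvd f"
proof (rule ccontr)
  assume nd: "\<not> r dvd f"
  have r0: "r \<noteq> 0" "\<not> r dvd 1" using r by (auto simp: irreducible_def)
  then have "vars r \<noteq> {}" using unit_iff_vars[of r] by simp
  then obtain i where i: "i \<in> vars r" by auto
  define V where "V = - {i}"
  have V: "i \<notin> V" "insert i V = UNIV" by (auto simp: V_def)
  obtain \<alpha> \<beta> c where c: "c \<noteq> 0" "vars c \<subseteq> V" "c = \<alpha> * f + \<beta> * r"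
    using bezout_eliminant[OF irreducibles_prime_in_any V(1) r i, of f] V nd by auto
  have "c * leading_coeff_in i r = 0"
  proof (rule mpoly_eqI)
    fix z
    show "eval_mpoly (c * leading_coeff_in i r) z = eval_mpoly 0 z"
    proof (cases "eval_mpoly (leading_coeff_in i r) z = 0")
      case False
      define Q where "Q = map_poly (\<lambda>c. eval_mpoly c z) (as_poly_in i r)"
      have eq: "eval_mpoly r (set_coord z i t) = poly Q t" for t
      proof -
        have "map_poly (\<lambda>c. eval_mpoly c (set_coord z i t)) (as_poly_in i r) = Q"
          unfolding Q_def
        proof (rule poly_eqI)
          fix n
          have "eval_mpoly (coeff (as_poly_in i r) n) (set_coord z i t) = eval_mpoly (coeff (as_poly_in i r) n) z"
            by (rule vars_eval_cong) (use notin_vars_coeff_as_poly_in[of i r n] in \<open>auto simp: set_coord_nth\<close>)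
          then show "coeff (map_poly (\<lambda>c. eval_mpoly c (set_coord z i t)) (as_poly_in i r)) n
              = coeff (map_poly (\<lambda>c. eval_mpoly c z) (as_poly_in i r)) n"
            by (simp add: coeff_map_poly)
        qed
        then show ?thesis using eval_poly[of "as_poly_in i r" "var i" "set_coord z i t"]
          by (simp add: set_coord_nth)
      qed
      have "coeff Q (degree_in i r) \<noteq> 0" using False by (simp add: Q_def coeff_map_poly leading_coeff_in_def)
      then have "degree Q > 0" using i le_degree[of Q "degree_in i r"] by (simp add: in_vars_iff_degree_in)
      then have "\<not> constant (poly Q)" by (simp add: constant_degree)
      then obtain t where t: "poly Q t = 0" using Fundamental_Theorem_Algebra.fundamental_theorem_of_algebra[of Q] by auto
      define w where "w = set_coord z i t"
      have w: "eval_mpoly r w = 0" using t eq by (simp add: w_def)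
      then have "eval_mpoly f w = 0" using zero by (simp add: zero_set_def)
      then have "eval_mpoly c w = 0" using c(3) w by (simp add: eval_mpoly_add eval_mpoly_mult)
      moreover have "eval_mpoly c w = eval_mpoly c z"
        by (rule vars_eval_cong) (use c(2) V in \<open>auto simp: w_def set_coord_nth\<close>)
      ultimately show ?thesis by (simp add: eval_mpoly_mult)
    qed (simp add: eval_mpoly_mult)
  qed
  then show False using c(1) r0 by simp
qed

section \<open>Reflection\<close>

lemma lookup_reflection:
  assumes "m \<in> Poly_Mapping.keys p"
  shows "Poly_Mapping.lookup (reflection p) (multidegree p - m) = cnj (Poly_Mapping.lookup p m)"
proof -
  have "Poly_Mapping.lookup (reflection p) (multidegree p - m)
    = (\<Sum>k\<in>Poly_Mapping.keys p. if k = m then cnj (Poly_Mapping.lookup p m) else 0)"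
    unfolding reflection_def lookup_sum
  proof (rule sum.cong)
    fix k assume k: "k \<in> Poly_Mapping.keys p"
    have "k = m" if e: "multidegree p - k = multidegree p - m"
    proof (rule poly_mapping_eqI)
      fix i
      have "Poly_Mapping.lookup (multidegree p) i - Poly_Mapping.lookup k i
          = Poly_Mapping.lookup (multidegree p) i - Poly_Mapping.lookup m i"
        using e by (metis lookup_minus)
      then show "Poly_Mapping.lookup k i = Poly_Mapping.lookup m i"
        using lookup_le_multidegree[OF k, of i] lookup_le_multidegree[OF assms, of i] by linarith
    qed
    then show "Poly_Mapping.lookup (Poly_Mapping.single (multidegree p - k) (cnj (Poly_Mapping.lookup p k))) (multidegree p - m)
       = (if k = m then cnj (Poly_Mapping.lookup p m) else 0)"
      by (auto simp: lookup_single when_def)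
  qed simp
  then show ?thesis using assms by simp
qed

lemma keys_reflection: "Poly_Mapping.keys (reflection p) \<subseteq> (\<lambda>m. multidegree p - m) ` Poly_Mapping.keys p"
proof
  fix k assume "k \<in> Poly_Mapping.keys (reflection p)"
  then have "k \<in> (\<Union>m\<in>Poly_Mapping.keys p. Poly_Mapping.keys (Poly_Mapping.single (multidegree p - m) (cnj (Poly_Mapping.lookup p m))))"
    unfolding reflection_def by (rule subsetD[OF Poly_Mapping.keys_sum])
  then show "k \<in> (\<lambda>m. multidegree p - m) ` Poly_Mapping.keys p"
    by (auto split: if_splits)
qed

lemma reflection_0 [simp]: "reflection 0 = 0"
  by (simp add: reflection_def)

lemma reflection_eq_0_iff [simp]: "reflection p = 0 \<longleftrightarrow> p = 0"
proof
  assume r: "reflection p = 0"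
  show "p = 0"
  proof (rule ccontr)
    assume "p \<noteq> 0"
    then have "Poly_Mapping.keys p \<noteq> {}" by simp
    then obtain m where m: "m \<in> Poly_Mapping.keys p" by blast
    show False using lookup_reflection[OF m] r m by (simp add: in_keys_iff)
  qed
qed simp

lemma degree_in_reflection_le: "degree_in i (reflection p) \<le> degree_in i p"
proof -
  have "Poly_Mapping.lookup (multidegree (reflection p)) i \<le> Poly_Mapping.lookup (multidegree p) i"
    unfolding lookup_multidegree[of "reflection p"]
    using keys_reflection[of p] by (intro Max.boundedI) (auto simp: lookup_minus)
  then show ?thesis by (simp add: lookup_multidegree_eq_degree_in)
qed

lemma eval_mpoly_at_0: "eval_mpoly p 0 = Poly_Mapping.lookup p 0"
proof -
  have *: "monom_at (0 :: complex ^ 'n) m = (if m = 0 then 1 else 0)" for m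
  proof (cases "m = 0")
    case False
    then obtain i where "Poly_Mapping.lookup m i \<noteq> 0" using poly_mapping_eqI[of m 0] by auto
    then have "monom_at (0 :: complex ^ 'n) m = 0" unfolding monom_at_eq_0_iff by auto
    then show ?thesis using False by simp
  qed simp
  show ?thesis by (simp add: eval_mpoly_def * if_distrib in_keys_iff cong: if_cong)
qed

text \<open>
  In general the degrees can drop, namely for polynomials divisible by a variable.
\<close>

lemma multidegree_reflection:
  assumes "eval_mpoly p 0 \<noteq> 0"
  shows "multidegree (reflection p) = multidegree p"
proof (rule poly_mapping_eqI)
  fix i
  have "0 \<in> Poly_Mapping.keys p" using assms by (simp add: eval_mpoly_at_0 in_keys_iff)
  then have "multidegree p \<in> Poly_Mapping.keys (reflection p)"
    using lookup_reflection[of 0 p] by (simp add: in_keys_iff)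
  then have "Poly_Mapping.lookup (multidegree p) i \<le> Poly_Mapping.lookup (multidegree (reflection p)) i"
    by (rule lookup_le_multidegree)
  then show "Poly_Mapping.lookup (multidegree (reflection p)) i = Poly_Mapping.lookup (multidegree p) i"
    using degree_in_reflection_le[of i p] by (simp add: lookup_multidegree_eq_degree_in)
qed

lemma reflection_mult:
  fixes p q :: "'n::finite mpoly"
  shows "reflection (p * q) = reflection p * reflection q"
proof (cases "p = 0 \<or> q = 0")
  case False
  show ?thesis
    by (rule mpoly_eqI_polydisc)
      (use False in \<open>simp add: eval_reflection eval_mpoly_mult multidegree_mult monom_at_add mult_ac\<close>)
qed auto

lemma reflection_const [simp]: "reflection (const_mpoly c :: 'n::finite mpoly) = const_mpoly (cnj c)"
proof -
  have "multidegree (const_mpoly c :: 'n::finite mpoly) = 0"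
    by (rule poly_mapping_eqI) (simp add: lookup_multidegree_eq_degree_in degree_in_def as_poly_in_const)
  then show ?thesis
    by (intro mpoly_eqI_polydisc) (simp add: eval_reflection)
qed

text \<open>
  Without a constant term this can fail: the reflection of a variable is 1.
\<close>

lemma reflection_reflection:
  fixes p :: "'n::finite mpoly"
  assumes "eval_mpoly p 0 \<noteq> 0"
  shows "reflection (reflection p) = p"
proof (rule mpoly_eqI_polydisc)
  fix z :: "complex ^ 'n" assume z: "\<And>i. z $ i \<noteq> 0"
  have z': "(\<chi> i. 1 / cnj (z $ i)) $ j \<noteq> 0" for j using z by simp
  have "monom_at z m * cnj (monom_at (\<chi> i. 1 / cnj (z $ i)) m) = 1" for m
    using z by (simp add: monom_at_def prod.distrib[symmetric] power_mult_distrib[symmetric])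
  then show "eval_mpoly (reflection (reflection p)) z = eval_mpoly p z"
    using eval_reflection[of z "reflection p"] z eval_reflection[of "\<chi> i. 1 / cnj (z $ i)" p]
    by (simp add: multidegree_reflection[OF assms] mult.assoc[symmetric])
qed

lemma torus_nz: "z \<in> torus \<Longrightarrow> z $ i \<noteq> 0"
  by (metis (mono_tags, lifting) mem_Collect_eq norm_zero torus_def zero_neq_one)

lemma torus_inv: "z \<in> torus \<Longrightarrow> 1 / cnj (z $ i) = z $ i"
  using complex_norm_square[of "z $ i"] torus_nz[of z i] by (simp add: torus_def field_simps)

lemma reflection_on_torus:
  assumes "z \<in> torus"
  shows "eval_mpoly (reflection p) z = monom_at z (multidegree p) * cnj (eval_mpoly p z)"
  using eval_reflection[of z p] torus_nz[OF assms] torus_inv[OF assms] by simp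

section \<open>Self-reflective polynomials\<close>

text \<open>
  It holds for a linear factor with root \<open>a\<close> on the unit circle, since then
  \<open>x * cnj (1 / cnj x - a) = - cnj a * (x - a)\<close>, and is multiplicative.
\<close>

lemma unimodular_roots_self_reciprocal:
  fixes S :: "complex poly"
  assumes "S \<noteq> 0" "\<And>x. poly S x = 0 \<Longrightarrow> norm x = 1"
  shows "\<exists>c. c \<noteq> 0 \<and> (\<forall>x. x \<noteq> 0 \<longrightarrow> x ^ degree S * cnj (poly S (1 / cnj x)) = c * poly S x)"
  using assms
proof (induction "degree S" arbitrary: S)
  case 0
  then obtain a where a: "S = [:a:]" using degree_eq_zeroE by metis
  then show ?case using 0 by (intro exI[of _ "cnj a / a"]) auto
next
  case (Suc n)
  then have "\<not> constant (poly S)" by (simp add: constant_degree)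
  then obtain a where a: "poly S a = 0" using Fundamental_Theorem_Algebra.fundamental_theorem_of_algebra[of S] by auto
  then obtain T where T: "S = [:- a, 1:] * T" by (auto simp: poly_eq_0_iff_dvd dvd_def)
  have "T \<noteq> 0" using Suc.prems T by auto
  have d: "degree S = Suc (degree T)" unfolding T using \<open>T \<noteq> 0\<close> by (subst degree_mult_eq) auto
  have na: "norm a = 1" using Suc.prems a by blast
  have a1: "a \<noteq> 0" "cnj a * a = 1" using na complex_norm_square[of a] by (auto simp: mult.commute)
  obtain c where c: "c \<noteq> 0" "\<And>x. x \<noteq> 0 \<Longrightarrow> x ^ degree T * cnj (poly T (1 / cnj x)) = c * poly T x"
    using Suc.hyps(1)[of T] Suc.hyps(2) Suc.prems(2) d \<open>T \<noteq> 0\<close> T by (auto simp: poly_mult)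
  have "x ^ degree S * cnj (poly S (1 / cnj x)) = (- cnj a * c) * poly S x" if x: "x \<noteq> 0" for x
  proof -
    have "x * cnj (1 / cnj x - a) = 1 - cnj a * x" using x by (simp add: field_simps)
    also have "\<dots> = - cnj a * (x - a)" using a1 by (simp add: algebra_simps)
    finally have e: "x * cnj (1 / cnj x - a) = - cnj a * (x - a)" .
    have pS: "poly S y = (y - a) * poly T y" for y by (simp add: T algebra_simps)
    have "x ^ degree S * cnj (poly S (1 / cnj x)) =
        (x * cnj (1 / cnj x - a)) * (x ^ degree T * cnj (poly T (1 / cnj x)))"
      by (simp add: d pS mult_ac)
    also have "\<dots> = (- cnj a * (x - a)) * (c * poly T x)" unfolding e c(2)[OF x] by simp
    finally show ?thesis by (simp add: pS mult_ac)
  qed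
  then show ?case using c(1) a1 by (intro exI[of _ "- cnj a * c"]) auto
qed

definition self_reflective :: "'n::finite mpoly \<Rightarrow> bool" where
  "self_reflective p \<longleftrightarrow> (\<exists>c. c \<noteq> 0 \<and> reflection p = const_mpoly c * p)"

text \<open>
  The univariate polynomial \<open>t \<mapsto> p (t z)\<close>. The explicit form shows how its coefficients depend on \<open>z\<close>.
\<close>

definition on_line :: "complex ^ 'n \<Rightarrow> 'n::finite mpoly \<Rightarrow> complex poly" where
  "on_line z p = (\<Sum>m\<in>Poly_Mapping.keys p.
     monom (Poly_Mapping.lookup p m * monom_at z m) (\<Sum>i\<in>UNIV. Poly_Mapping.lookup m i))"

lemma monom_at_scale: "monom_at (t *s z) m = t ^ (\<Sum>i\<in>UNIV. Poly_Mapping.lookup m i) * monom_at z m"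
  by (simp add: monom_at_def power_mult_distrib prod.distrib power_sum)

lemma poly_on_line: "poly (on_line z p) t = eval_mpoly p (t *s z)"
  by (simp add: on_line_def eval_mpoly_def poly_sum poly_monom monom_at_scale mult_ac)

lemma torus_scale_polydisc: "z \<in> torus \<Longrightarrow> norm t < 1 \<Longrightarrow> t *s z \<in> polydisc"
  by (auto simp: torus_def polydisc_def norm_mult)

lemma eval_reflection_scaled_torus:
  assumes "z \<in> torus" "t \<noteq> 0"
  shows "eval_mpoly (reflection p) (t *s z) = monom_at (t *s z) (multidegree p) * cnj (eval_mpoly p ((1 / cnj t) *s z))"
proof -
  have "(\<chi> i. 1 / cnj ((t *s z) $ i)) = (1 / cnj t) *s z"
    using torus_inv[OF assms(1)] by (simp add: vec_eq_iff) (metis divide_divide_eq_left' mult.right_neutral times_divide_eq_right)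
  moreover have "\<And>i. (t *s z) $ i \<noteq> 0" using torus_nz[OF assms(1)] assms(2) by simp
  ultimately show ?thesis using eval_reflection[of "t *s z" p] by simp
qed

text \<open>
  On the line through 0 and a point \<open>z\<close> of the torus, \<open>s\<close> restricts to a univariate polynomial \<open>S\<close>. It has no roots
  inside the unit circle, and none outside since these would be reflected to zeros of the reflection of \<open>s\<close>.
  So \<open>S\<close> and the restriction \<open>R\<close> of the reflection agree up to a constant and a power of the variable,
  which is trivial because neither vanishes at 0. Comparing the values at 0 shows that the constant does not
  depend on \<open>z\<close>.
\<close>

lemma zero_free_reflection_imp_self_reflective:
  fixes s :: "'n::finite mpoly"
  assumes s: "\<And>z. z \<in> polydisc \<Longrightarrow> eval_mpoly s z \<noteq> 0"
    and r: "\<And>z. z \<in> polydisc \<Longrightarrow> eval_mpoly (reflection s) z \<noteq> 0"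
  shows "self_reflective s"
proof -
  define k where "k = eval_mpoly (reflection s) 0 / eval_mpoly s 0"
  have "0 \<in> (polydisc :: (complex ^ 'n) set)" by (simp add: polydisc_def)
  then have s0: "eval_mpoly s 0 \<noteq> 0" "eval_mpoly (reflection s) 0 \<noteq> 0" using s r by blast+
  have "eval_mpoly (reflection s) z = k * eval_mpoly s z" if z: "z \<in> torus" for z
  proof -
    define S where "S = on_line z s"
    define R where "R = on_line z (reflection s)"
    define N where "N = (\<Sum>i\<in>UNIV. Poly_Mapping.lookup (multidegree s) i)"
    have S0: "poly S 0 = eval_mpoly s 0" "poly R 0 = eval_mpoly (reflection s) 0"
      by (simp_all add: S_def R_def poly_on_line)
    then have "S \<noteq> 0" using s0 by auto
    have roots: "norm x = 1" if x: "poly S x = 0" for x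
    proof (rule ccontr)
      assume "norm x \<noteq> 1"
      then consider "norm x < 1" | "norm x > 1" by linarith
      then show False
      proof cases
        case 1
        then show False using s torus_scale_polydisc[OF z, of x] x by (simp add: S_def poly_on_line)
      next
        case 2
        then have "x \<noteq> 0" by auto
        have "norm (1 / cnj x) < 1" using 2 \<open>x \<noteq> 0\<close> by (simp add: norm_divide divide_less_eq)
        then have "eval_mpoly (reflection s) ((1 / cnj x) *s z) \<noteq> 0"
          using r torus_scale_polydisc[OF z] by blast
        moreover have "eval_mpoly (reflection s) ((1 / cnj x) *s z) = 0"
          using eval_reflection_scaled_torus[OF z, of "1 / cnj x" s] x \<open>x \<noteq> 0\<close>
          by (simp add: S_def poly_on_line)
        ultimately show False by simp
      qed
    qed
    obtain c where c: "c \<noteq> 0" "\<And>x. x \<noteq> 0 \<Longrightarrow> x ^ degree S * cnj (poly S (1 / cnj x)) = c * poly S x"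
      using unimodular_roots_self_reciprocal[OF \<open>S \<noteq> 0\<close> roots] by blast
    define m where "m = monom_at z (multidegree s) * c"
    have m: "m \<noteq> 0" using c torus_nz[OF z] by (simp add: m_def monom_at_eq_0_iff)
    have *: "x ^ degree S * poly R x = m * x ^ N * poly S x" if x: "x \<noteq> 0" for x
    proof -
      have "poly R x = x ^ N * monom_at z (multidegree s) * cnj (poly S (1 / cnj x))"
        using eval_reflection_scaled_torus[OF z x, of s]
        by (simp add: R_def S_def poly_on_line monom_at_scale N_def)
      then show ?thesis using c(2)[OF x] by (simp add: m_def mult_ac)
    qed
    \<comment> \<open>the extra factor \<open>monom 1 1\<close> makes the identity, known for \<open>x \<noteq> 0\<close>, hold trivially at 0\<close>
    have "poly (monom 1 1 * (monom 1 (degree S) * R - smult m (monom 1 N * S))) x = 0" for x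
      using *[of x] by (cases "x = 0") (auto simp: poly_monom)
    then have "monom 1 1 * (monom 1 (degree S) * R - smult m (monom 1 N * S)) = 0"
      using poly_all_0_iff_0 by blast
    then have eq: "monom 1 (degree S) * R = smult m (monom 1 N * S)"
      by (simp add: monom_eq_0_iff)
    have "coeff S 0 \<noteq> 0" "coeff R 0 \<noteq> 0" using S0 s0 by (simp_all add: poly_0_coeff_0)
    have "degree S = N"
    proof (rule ccontr)
      assume "degree S \<noteq> N"
      then consider "degree S < N" | "N < degree S" by linarith
      then show False
      proof cases
        case 1
        then show False using arg_cong[OF eq, of "\<lambda>p. coeff p (degree S)"] \<open>coeff R 0 \<noteq> 0\<close>
          by (simp add: coeff_monom_mult)
      next
        case 2
        then show False using arg_cong[OF eq, of "\<lambda>p. coeff p N"] \<open>coeff S 0 \<noteq> 0\<close> m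
          by (simp add: coeff_monom_mult)
      qed
    qed
    then have "monom 1 N * R = monom 1 N * smult m S" using eq by simp
    then have RS: "R = smult m S" by (metis mult_left_cancel monom_eq_0_iff one_neq_zero)
    then have "poly R 0 = m * poly S 0" by simp
    then have "m = k" using S0 s0 by (simp add: k_def)
    then show ?thesis using arg_cong[OF RS, of "\<lambda>p. poly p 1"]
      by (simp add: R_def S_def poly_on_line)
  qed
  then have "reflection s = const_mpoly k * s"
    by (intro mpoly_eqI_torus) (simp add: eval_mpoly_mult)
  moreover have "k \<noteq> 0" using s0 by (simp add: k_def)
  ultimately show ?thesis unfolding self_reflective_def by blast
qed

lemma self_reflective_mult: "self_reflective p \<Longrightarrow> self_reflective q \<Longrightarrow> self_reflective (p * q)"
  unfolding self_reflective_def
proof (elim exE conjE)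
  fix c d assume cd: "c \<noteq> 0" "d \<noteq> 0" and e: "reflection p = const_mpoly c * p" "reflection q = const_mpoly d * q"
  have "reflection (p * q) = (const_mpoly c * const_mpoly d) * (p * q)"
    by (simp add: reflection_mult e mult_ac)
  then show "\<exists>c. c \<noteq> 0 \<and> reflection (p * q) = const_mpoly c * (p * q)"
    using cd by (intro exI[of _ "c * d"]) (simp add: const_mpoly_mult)
qed

lemma self_reflective_const: "c \<noteq> 0 \<Longrightarrow> self_reflective (const_mpoly c)"
  unfolding self_reflective_def by (intro exI[of _ "cnj c / c"]) (simp add: const_mpoly_mult)

text \<open>
  The degrees of the reflection do not exceed those of \<open>r\<close>, so the quotient is constant.
\<close>

lemma self_reflective_if_dvd_reflection:
  assumes "r dvd reflection r" "r \<noteq> 0"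
  shows "self_reflective r"
proof -
  obtain u where u: "reflection r = r * u" using assms by (auto simp: dvd_def)
  have "u \<noteq> 0" using u assms(2) by (metis mult_zero_right reflection_eq_0_iff)
  have "degree_in i u = 0" for i
    using degree_in_reflection_le[of i r] degree_in_mult[OF assms(2) \<open>u \<noteq> 0\<close>, of i] u by simp
  then have "vars u = {}" using in_vars_iff_degree_in[of _ u] by auto
  then obtain c where "u = const_mpoly c" using vars_empty_iff by blast
  then show ?thesis using u \<open>u \<noteq> 0\<close> unfolding self_reflective_def
    by (intro exI[of _ c]) (auto simp: mult.commute)
qed

lemma self_reflective_dvd: "self_reflective r \<Longrightarrow> r dvd reflection r"
  unfolding self_reflective_def by auto

lemma self_reflective_if_factors:
  assumes "a \<noteq> 0" "\<And>r. irreducible r \<Longrightarrow> r dvd a \<Longrightarrow> r dvd reflection r"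
  shows "self_reflective a"
  using assms
proof (induction a rule: factor_induct)
  case (factor r p)
  have "self_reflective r"
    using factor self_reflective_if_dvd_reflection[of r] by (auto simp: irreducible_def)
  moreover have "self_reflective p"
    using factor.IH factor.prems by (meson dvd_mult)
  ultimately show ?case by (rule self_reflective_mult)
qed (rule self_reflective_const)

section \<open>Irreducible components and torality\<close>

text \<open>
  Complex homogeneous derivatives exist for constants and coordinates and are inherited by sums and products.
\<close>

lemma holomorphic_mv_eval: "holomorphic_mv (eval_mpoly (p :: 'n::finite mpoly)) U"
proof -
  let ?D = "\<lambda>f z. \<exists>L. (f has_derivative L) (at z) \<and> (\<forall>c v. L (c *s v) = c * (L v :: complex))"
  have const: "?D (\<lambda>z. c) z" for c and z :: "complex ^ 'n"
    by (intro exI[of _ "\<lambda>v. 0"]) auto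
  have proj: "?D (\<lambda>z. z $ i) z" for i and z :: "complex ^ 'n"
    by (intro exI[of _ "\<lambda>v. v $ i"]) (auto intro!: bounded_linear_imp_has_derivative bounded_linear_vec_nth)
  have add: "?D (\<lambda>z. f z + g z) z" if "?D f z" "?D g z" for f g and z :: "complex ^ 'n"
  proof -
    from that obtain L M where L: "(f has_derivative L) (at z)" "\<forall>c v. L (c *s v) = c * L v"
      and M: "(g has_derivative M) (at z)" "\<forall>c v. M (c *s v) = c * M v" by blast
    show ?thesis
      by (rule exI[of _ "\<lambda>v. L v + M v"]) (use L M in \<open>auto intro!: derivative_intros simp: algebra_simps\<close>)
  qed
  have mult: "?D (\<lambda>z. f z * g z) z" if "?D f z" "?D g z" for f g and z :: "complex ^ 'n"
  proof -
    from that obtain L M where L: "(f has_derivative L) (at z)" "\<forall>c v. L (c *s v) = c * L v"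
      and M: "(g has_derivative M) (at z)" "\<forall>c v. M (c *s v) = c * M v" by blast
    have "((\<lambda>z. f z * g z) has_derivative (\<lambda>v. f z * M v + L v * g z)) (at z)"
      by (rule has_derivative_mult[OF L(1) M(1)])
    then show ?thesis
      by (rule exI[of _ "\<lambda>v. f z * M v + L v * g z", OF conjI]) (use L M in \<open>simp add: algebra_simps\<close>)
  qed
  have pow: "?D (\<lambda>z. z $ i ^ k) z" for i k and z :: "complex ^ 'n"
  proof (induction k)
    case 0 show ?case using const[of 1] by simp
  next
    case (Suc k) show ?case using mult[OF proj Suc] by simp
  qed
  have prod: "?D (\<lambda>z. \<Prod>i\<in>A. z $ i ^ Poly_Mapping.lookup m i) z" if "finite A" for A m and z :: "complex ^ 'n"
    using that
  proof (induction A)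
    case empty show ?case using const[of 1] by simp
  next
    case (insert i A) show ?case using mult[OF pow insert.IH] insert.hyps by simp
  qed
  have sum: "?D (\<lambda>z. \<Sum>m\<in>A. Poly_Mapping.lookup p m * monom_at z m) z" if "finite A" for A and z :: "complex ^ 'n"
    using that
  proof (induction A)
    case empty show ?case using const[of 0] by simp
  next
    case (insert m A)
    have "?D (\<lambda>z. Poly_Mapping.lookup p m * monom_at z m) z"
      using mult[OF const prod[of UNIV m]] by (simp add: monom_at_def)
    from add[OF this insert.IH] show ?case using insert.hyps by simp
  qed
  show ?thesis unfolding holomorphic_mv_def eval_mpoly_def[abs_def] using sum by auto
qed

lemma eval_mpoly_in_Hol: "eval_mpoly p \<in> Hol A"
  unfolding Hol_def using holomorphic_mv_eval[of p UNIV] by blast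

lemma algebraic_zero_set [simp]: "algebraic_set (zero_set p)"
  unfolding algebraic_set_def by (intro exI[of _ "{p}"]) auto

lemma algebraic_Int_zero_set: "algebraic_set A \<Longrightarrow> algebraic_set (A \<inter> zero_set p)"
  unfolding algebraic_set_def
proof (elim exE conjE)
  fix P assume "finite P" "A = (\<Inter>p\<in>P. zero_set p)"
  then show "\<exists>P. finite P \<and> A \<inter> zero_set p = (\<Inter>p\<in>P. zero_set p)"
    by (intro exI[of _ "insert p P"]) auto
qed

lemma zero_set_mult: "zero_set (p * q) = zero_set p \<union> zero_set q"
  by (auto simp: zero_set_def eval_mpoly_mult)

lemma zero_set_dvd: "p dvd q \<Longrightarrow> zero_set p \<subseteq> zero_set q"
  by (auto simp: zero_set_mult dvd_def)

lemma algebraic_proper_subset_polynomial: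
  assumes "algebraic_set B" "z \<notin> B"
  obtains \<beta> where "eval_mpoly \<beta> z \<noteq> 0" "B \<subseteq> zero_set \<beta>"
proof -
  obtain P where P: "B = (\<Inter>p\<in>P. zero_set p)" using assms by (auto simp: algebraic_set_def)
  then obtain \<beta> where "\<beta> \<in> P" "z \<notin> zero_set \<beta>" using assms by auto
  then show ?thesis using that[of \<beta>] P by (auto simp: zero_set_def)
qed

text \<open>
  If the zero set of \<open>r\<close> were covered by two algebraic sets that are properly smaller, polynomials \<open>\<beta>\<close> and \<open>\<gamma>\<close>
  vanishing on one each but not on the whole zero set would have a product divisible by the prime \<open>r\<close>.
\<close>

lemma irreducible_algebraic_zero_set:
  fixes r :: "'n::finite mpoly"
  assumes r: "irreducible r"
  shows "irreducible_algebraic_set (zero_set r)"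
  unfolding irreducible_algebraic_set_def
proof (intro conjI allI impI)
  show "zero_set r \<noteq> {}"
    using irreducible_nullstellensatz[OF r, of 1] r by (auto simp: irreducible_def)
  fix B C :: "(complex ^ 'n) set"
  assume B: "algebraic_set B" and C: "algebraic_set C" and BC: "zero_set r = B \<union> C"
  show "B = zero_set r \<or> C = zero_set r"
  proof (rule ccontr)
    assume "\<not> (B = zero_set r \<or> C = zero_set r)"
    then obtain y z where y: "y \<in> zero_set r" "y \<notin> B" and z: "z \<in> zero_set r" "z \<notin> C"
      using BC by blast
    obtain \<beta> where \<beta>: "eval_mpoly \<beta> y \<noteq> 0" "B \<subseteq> zero_set \<beta>"
      using algebraic_proper_subset_polynomial[OF B y(2)] by blast
    obtain \<gamma> where \<gamma>: "eval_mpoly \<gamma> z \<noteq> 0" "C \<subseteq> zero_set \<gamma>"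
      using algebraic_proper_subset_polynomial[OF C z(2)] by blast
    have "r dvd \<beta> * \<gamma>"
      by (rule irreducible_nullstellensatz[OF r]) (use BC \<beta> \<gamma> in \<open>auto simp: eval_mpoly_mult zero_set_def\<close>)
    then have "r dvd \<beta> \<or> r dvd \<gamma>" by (rule irreducible_mpoly_dvd_multD[OF r])
    then show False using zero_set_dvd[of r \<beta>] zero_set_dvd[of r \<gamma>] y z \<beta> \<gamma> by (auto simp: zero_set_def)
  qed
qed simp

lemma irreducible_subset_factor:
  fixes b :: "'n::finite mpoly"
  assumes W: "irreducible_algebraic_set W" and "b \<noteq> 0" "W \<subseteq> zero_set b"
  shows "\<exists>r. irreducible r \<and> r dvd b \<and> W \<subseteq> zero_set r"
  using assms(2-)
proof (induction b rule: factor_induct)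
  case (unit c)
  then have "W = {}" by (auto simp: zero_set_def)
  then show ?case using W by (simp add: irreducible_algebraic_set_def)
next
  case (factor r p)
  have "W = (W \<inter> zero_set r) \<union> (W \<inter> zero_set p)" using factor.prems by (auto simp: zero_set_mult)
  then have "W \<inter> zero_set r = W \<or> W \<inter> zero_set p = W"
    using W algebraic_Int_zero_set unfolding irreducible_algebraic_set_def by metis
  then show ?case
  proof
    assume "W \<inter> zero_set r = W"
    then show ?thesis using factor.hyps by (intro exI[of _ r]) auto
  next
    assume "W \<inter> zero_set p = W"
    then show ?thesis using factor.IH by (metis dvd_mult inf.absorb_iff1)
  qed
qed

text \<open>
  An irreducible component of the zero set of \<open>b\<close> is the zero set of an irreducible factor \<open>r\<close>. The reflection
  of \<open>r\<close> vanishes at its points on the torus, but not on all of it.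
\<close>

lemma atoralI:
  fixes b :: "'n::finite mpoly"
  assumes "b \<noteq> 0" and no: "\<And>r. irreducible r \<Longrightarrow> r dvd b \<Longrightarrow> \<not> r dvd reflection r"
  shows "atoral b"
  unfolding atoral_def atoral_set_def
proof (intro conjI allI impI)
  fix W :: "(complex ^ 'n) set"
  assume W: "irreducible_component W (zero_set b)"
  then have W1: "irreducible_algebraic_set W" "W \<subseteq> zero_set b"
    by (auto simp: irreducible_component_def)
  obtain r where r: "irreducible r" "r dvd b" "W \<subseteq> zero_set r"
    using irreducible_subset_factor[OF W1(1) assms(1) W1(2)] by blast
  have Wr: "zero_set r = W"
    using W irreducible_algebraic_zero_set[OF r(1)] r(3) zero_set_dvd[OF r(2)]
    unfolding irreducible_component_def by blast
  show "\<not> determining torus W"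
  proof
    assume "determining torus W"
    moreover have "\<forall>z\<in>torus \<inter> W. eval_mpoly (reflection r) z = 0"
      using Wr by (auto simp: reflection_on_torus zero_set_def)
    ultimately have "\<forall>z\<in>W. eval_mpoly (reflection r) z = 0"
      using eval_mpoly_in_Hol[of "reflection r" W] unfolding determining_def by blast
    then have "r dvd reflection r" using irreducible_nullstellensatz[OF r(1)] Wr by blast
    then show False using no r by blast
  qed
qed simp

lemma split_multiplicity:
  fixes a r :: "'n::finite mpoly"
  assumes "irreducible r" "a \<noteq> 0"
  shows "\<exists>k m. a = r ^ k * m \<and> \<not> r dvd m"
  using assms(2)
proof (induction "degree_sum a" arbitrary: a rule: less_induct)
  case less
  show ?case
  proof (cases "r dvd a")
    case False
    then show ?thesis by (intro exI[of _ 0] exI[of _ a]) auto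
  next
    case True
    then obtain b where b: "a = r * b" by (auto simp: dvd_def)
    then have nz: "r \<noteq> 0" "b \<noteq> 0" using less.prems by auto
    then have "degree_sum b < degree_sum a" using b irreducible_degree_sum_pos[OF assms(1)] by (simp add: degree_sum_mult)
    then obtain k m where "b = r ^ k * m" "\<not> r dvd m" using less.hyps nz by blast
    then show ?thesis using b by (intro exI[of _ "Suc k"] exI[of _ m]) (auto simp: mult_ac)
  qed
qed

text \<open>
  For an irreducible factor \<open>r\<close> of \<open>a\<close> write \<open>a = r ^ k * m\<close> with \<open>m\<close> prime to \<open>r\<close>. On the torus, the reflection of \<open>r\<close>
  vanishes where \<open>r\<close> does, so \<open>reflection r * m\<close> vanishes where \<open>a\<close> does. Torality extends this to all zeros
  of \<open>a\<close>, in particular to those of \<open>r\<close>, and the Nullstellensatz applies.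
\<close>

lemma toral_imp_self_reflective:
  fixes a :: "'n::finite mpoly"
  assumes "toral a" "a \<noteq> 0"
  shows "self_reflective a"
proof (rule self_reflective_if_factors[OF assms(2)])
  fix r assume r: "irreducible r" "r dvd a"
  obtain k m where a: "a = r ^ k * m" "\<not> r dvd m" using split_multiplicity[OF r(1) assms(2)] by blast
  have "eval_mpoly (reflection r * m) z = 0" if z: "z \<in> torus" "z \<in> zero_set a" for z
  proof (cases "eval_mpoly r z = 0")
    case True
    then show ?thesis using z by (simp add: eval_mpoly_mult reflection_on_torus)
  next
    case False
    then show ?thesis using z a by (simp add: zero_set_def eval_mpoly_mult eval_mpoly_power)
  qed
  then have "\<forall>z\<in>zero_set a. eval_mpoly (reflection r * m) z = 0"
    using assms(1) eval_mpoly_in_Hol unfolding toral_def toral_set_def determining_def by blast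
  then have "r dvd reflection r * m"
    using irreducible_nullstellensatz[OF r(1)] zero_set_dvd[OF r(2)] by blast
  then show "r dvd reflection r" using irreducible_mpoly_dvd_multD[OF r(1)] a by blast
qed

section \<open>Contour integrals depending on a parameter\<close>

lemma continuous_on_contour_integral_param:
  fixes \<Phi> :: "'a::topological_space \<Rightarrow> complex \<Rightarrow> complex"
  assumes "continuous_on (U \<times> path_image g) (\<lambda>(s, w). \<Phi> s w)"
    and "valid_path g" "continuous_on {0..1} (\<lambda>t. vector_derivative g (at t))"
  shows "continuous_on U (\<lambda>s. contour_integral g (\<Phi> s))"
proof -
  have g: "continuous_on {0..1} g"
    using assms(2) by (simp add: valid_path_imp_path path_def[symmetric])
  have "continuous_on (U \<times> {0..1}) (\<lambda>x. (\<lambda>(s, w). \<Phi> s w) (fst x, g (snd x)))"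
    by (rule continuous_on_compose2[OF assms(1)])
      (auto intro!: continuous_intros continuous_on_compose2[OF g] simp: path_image_def)
  moreover have "continuous_on (U \<times> {0..1}) (\<lambda>x. vector_derivative g (at (snd x)))"
    by (rule continuous_on_compose2[OF assms(3)]) (auto intro!: continuous_intros)
  ultimately have "continuous_on (U \<times> cbox 0 1) (\<lambda>(s, t). \<Phi> s (g t) * vector_derivative g (at t))"
    by (auto simp: case_prod_unfold intro!: continuous_intros)
  from integral_continuous_on_param[OF this] show ?thesis
    by (simp add: contour_integral_integral)
qed

text \<open>
  Morera's theorem: the integral over a triangle is interchanged with the contour integral and
  vanishes by Cauchy's theorem in \<open>s\<close>.
\<close>

lemma holomorphic_on_contour_integral_param:
  fixes \<Phi> :: "complex \<Rightarrow> complex \<Rightarrow> complex"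
  assumes U: "open U" and cont: "continuous_on (U \<times> path_image g) (\<lambda>(s, w). \<Phi> s w)"
    and hol: "\<And>w. w \<in> path_image g \<Longrightarrow> (\<lambda>s. \<Phi> s w) holomorphic_on U"
    and g: "valid_path g" "continuous_on {0..1} (\<lambda>t. vector_derivative g (at t))"
  shows "(\<lambda>s. contour_integral g (\<Phi> s)) holomorphic_on U"
proof -
  let ?S = "\<lambda>s. contour_integral g (\<Phi> s)"
  have lin: "continuous_on {0..1} (\<lambda>t. vector_derivative (linepath a b) (at t))" for a b :: complex
    by (auto intro!: continuous_intros)
  have "?S analytic_on U"
  proof (rule Morera_triangle[OF _ U], goal_cases)
    case 1
    show ?case by (rule continuous_on_contour_integral_param[OF cont g])
  next
    case (2 a b c)
    show ?case
    proof
      assume T: "convex hull {a, b, c} \<subseteq> U"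
      define L where "L p q = (\<lambda>w. contour_integral (linepath p q) (\<lambda>s. \<Phi> s w))" for p q
      have seg: "path_image (linepath p q) \<subseteq> U" if "{p, q} \<subseteq> {a, b, c}" for p q
        using that T hull_mono[of "{p, q}" "{a, b, c}" convex] by (simp add: segment_convex_hull)
      have sub: "continuous_on (path_image (linepath p q) \<times> path_image g) (\<lambda>(s, w). \<Phi> s w)"
        if "{p, q} \<subseteq> {a, b, c}" for p q
        by (rule continuous_on_subset[OF cont]) (use seg[OF that] in auto)
      have sw: "contour_integral (linepath p q) ?S = contour_integral g (L p q)"
        if "{p, q} \<subseteq> {a, b, c}" for p q
        unfolding L_def by (rule contour_integral_swap[OF sub[OF that] _ g(1) lin g(2)]) auto
      have int: "L p q contour_integrable_on g" if pq: "{p, q} \<subseteq> {a, b, c}" for p q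
      proof -
        have "continuous_on (path_image g \<times> path_image (linepath p q)) (\<lambda>x. (\<lambda>(s, w). \<Phi> s w) (snd x, fst x))"
          by (rule continuous_on_compose2[OF sub[OF pq]]) (auto intro!: continuous_intros)
        then have "continuous_on (path_image g) (L p q)"
          unfolding L_def
          by (intro continuous_on_contour_integral_param[OF _ _ lin]) (auto simp: case_prod_unfold)
        moreover have "valid_path g" "continuous_on {0..1} g" using g by (auto simp: valid_path_imp_path path_def[symmetric])
        ultimately have "continuous_on {0..1} (\<lambda>t. L p q (g t) * vector_derivative g (at t))"
          by (intro continuous_intros g(2)) (auto intro: continuous_on_compose2 simp: path_image_def)
        then show ?thesis
          unfolding contour_integrable_on by (rule integrable_continuous_real)
      qed
      have z: "L a b w + L b c w + L c a w = 0" if w: "w \<in> path_image g" for w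
        unfolding L_def
        by (rule has_chain_integral_chain_integral3[OF Cauchy_theorem_triangle])
          (rule holomorphic_on_subset[OF hol[OF w] T])
      have "contour_integral (linepath a b) ?S + contour_integral (linepath b c) ?S + contour_integral (linepath c a) ?S
          = contour_integral g (\<lambda>w. L a b w + L b c w + L c a w)"
        by (simp add: sw int contour_integral_add contour_integrable_add)
      also have "\<dots> = contour_integral g (\<lambda>w. 0)"
        by (rule contour_integral_cong) (auto simp: z)
      finally show "contour_integral (linepath a b) ?S + contour_integral (linepath b c) ?S
          + contour_integral (linepath c a) ?S = 0" by simp
    qed
  qed
  then show ?thesis by (rule analytic_imp_holomorphic)
qed

text \<open>
  The argument principle with weight \<open>G\<close>, for a polynomial and a circle. The order of a zero is taken as
  \<open>zorder\<close>, in terms of which the argument principle is stated.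
\<close>

lemma contour_integral_weighted_roots:
  fixes Q :: "complex poly" and G :: "complex \<Rightarrow> complex"
  assumes e: "0 < e" "e < e'" and Q: "Q \<noteq> 0" and G: "G holomorphic_on ball \<rho> e'"
    and nz: "\<And>w. dist \<rho> w = e \<Longrightarrow> poly Q w \<noteq> 0"
  shows "contour_integral (circlepath \<rho> e) (\<lambda>w. poly (pderiv Q) w * G w / poly Q w)
    = 2 * pi * \<i> * (\<Sum>w\<in>{w. poly Q w = 0 \<and> w \<in> ball \<rho> e}. G w * zorder (poly Q) w)"
proof -
  define pz where "pz = {w \<in> ball \<rho> e'. poly Q w = 0 \<or> w \<in> {}}"
  have fin: "finite pz" using poly_roots_finite[OF Q] by (rule finite_subset[rotated]) (auto simp: pz_def)
  have "contour_integral (circlepath \<rho> e) (\<lambda>w. deriv (poly Q) w * G w / poly Q w)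
    = 2 * pi * \<i> * (\<Sum>w\<in>pz. winding_number (circlepath \<rho> e) w * G w * zorder (poly Q) w)"
    unfolding pz_def
  proof (rule argument_principle)
    show "path_image (circlepath \<rho> e) \<subseteq> ball \<rho> e' - {w \<in> ball \<rho> e'. poly Q w = 0 \<or> w \<in> {}}"
      using e nz by auto
    show "\<forall>z. z \<notin> ball \<rho> e' \<longrightarrow> winding_number (circlepath \<rho> e) z = 0"
      using e by (auto intro!: winding_number_zero_outside[where s = "cball \<rho> e"])
    show "finite {w \<in> ball \<rho> e'. poly Q w = 0 \<or> w \<in> {}}" using fin by (simp add: pz_def)
  qed (use G in \<open>auto intro!: holomorphic_intros\<close>)
  moreover have "deriv (poly Q) w = poly (pderiv Q) w" for w
    by (rule DERIV_imp_deriv) (rule poly_DERIV)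
  moreover have "(\<Sum>w\<in>pz. winding_number (circlepath \<rho> e) w * G w * zorder (poly Q) w)
    = (\<Sum>w\<in>{w. poly Q w = 0 \<and> w \<in> ball \<rho> e}. G w * zorder (poly Q) w)"
  proof (rule sum.mono_neutral_cong_right)
    show "{w. poly Q w = 0 \<and> w \<in> ball \<rho> e} \<subseteq> pz" using e by (auto simp: pz_def)
    show "\<forall>w\<in>pz - {w. poly Q w = 0 \<and> w \<in> ball \<rho> e}. winding_number (circlepath \<rho> e) w * G w * zorder (poly Q) w = 0"
    proof
      fix w assume "w \<in> pz - {w. poly Q w = 0 \<and> w \<in> ball \<rho> e}"
      then have "w \<notin> cball \<rho> e" using nz[of w] e by (auto simp: pz_def)
      then have "winding_number (circlepath \<rho> e) w = 0"
        using e by (intro winding_number_zero_outside[where s = "cball \<rho> e"]) auto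
      then show "winding_number (circlepath \<rho> e) w * G w * zorder (poly Q) w = 0" by simp
    qed
    fix w assume "w \<in> {w. poly Q w = 0 \<and> w \<in> ball \<rho> e}"
    then show "winding_number (circlepath \<rho> e) w * G w * zorder (poly Q) w = G w * zorder (poly Q) w"
      by (auto simp: winding_number_circlepath dist_norm norm_minus_commute)
  qed (rule fin)
  ultimately show ?thesis by simp
qed

section \<open>Sums over the points of a hypersurface on a moving line\<close>

lemma holomorphic_mv_continuous_on:
  assumes "holomorphic_mv g U"
  shows "continuous_on U g"
proof (rule continuous_at_imp_continuous_on, rule ballI)
  fix z assume "z \<in> U"
  then obtain L where "(g has_derivative L) (at z)" using assms by (auto simp: holomorphic_mv_def)
  then show "isCont g z" by (rule has_derivative_continuous)
qed

text \<open>
  The chain rule: the derivative of \<open>\<gamma>\<close> at \<open>s\<close> is \<open>h \<mapsto> h v\<close> for a vector \<open>v\<close>, and the derivative of \<open>g\<close> is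
  homogeneous over the complex numbers.
\<close>

lemma holomorphic_mv_compose:
  fixes \<gamma> :: "complex \<Rightarrow> complex ^ 'n::finite"
  assumes g: "holomorphic_mv g U" and T: "open T" and \<gamma>: "\<And>i. (\<lambda>s. \<gamma> s $ i) holomorphic_on T"
    and sub: "\<And>s. s \<in> T \<Longrightarrow> \<gamma> s \<in> U"
  shows "(\<lambda>s. g (\<gamma> s)) holomorphic_on T"
  unfolding holomorphic_on_open[OF T]
proof
  fix s assume s: "s \<in> T"
  obtain L where L: "(g has_derivative L) (at (\<gamma> s))" "\<forall>c v. L (c *s v) = c * L v"
    using g sub[OF s] by (auto simp: holomorphic_mv_def)
  have d: "((\<lambda>s. \<gamma> s $ i) has_field_derivative deriv (\<lambda>s. \<gamma> s $ i) s) (at s)" for i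
    by (rule holomorphic_derivI[OF \<gamma> T s])
  define v where "v = (\<chi> i. deriv (\<lambda>s. \<gamma> s $ i) s)"
  have "(\<gamma> has_derivative (\<lambda>h. h *s v)) (at s)"
    unfolding has_derivative_def
  proof
    have "linear (\<lambda>h :: complex. h *s v)"
      by (rule linearI) (auto simp: vec_eq_iff algebra_simps)
    then show "bounded_linear (\<lambda>h :: complex. h *s v)" by (simp add: linear_conv_bounded_linear)
    show "((\<lambda>y. (\<gamma> y - \<gamma> (Lim (at s) (\<lambda>x. x)) - (y - Lim (at s) (\<lambda>x. x)) *s v) /\<^sub>R norm (y - Lim (at s) (\<lambda>x. x))) \<longlongrightarrow> 0) (at s)"
    proof (rule vec_tendstoI)
      fix i
      have "((\<lambda>s. \<gamma> s $ i) has_derivative (\<lambda>h. h * deriv (\<lambda>s. \<gamma> s $ i) s)) (at s)"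
        using d[of i] by (simp add: has_field_derivative_def mult_commute_abs)
      then show "((\<lambda>y. ((\<gamma> y - \<gamma> (Lim (at s) (\<lambda>x. x)) - (y - Lim (at s) (\<lambda>x. x)) *s v) /\<^sub>R norm (y - Lim (at s) (\<lambda>x. x))) $ i) \<longlongrightarrow> 0 $ i) (at s)"
        by (simp add: has_derivative_def v_def algebra_simps)
    qed
  qed
  from has_derivative_compose[OF this L(1)]
  have "((\<lambda>s. g (\<gamma> s)) has_derivative (\<lambda>h. h * L v)) (at s)" using L(2) by simp
  then show "\<exists>f'. ((\<lambda>s. g (\<gamma> s)) has_field_derivative f') (at s)"
    by (intro exI[of _ "L v"]) (simp add: has_field_derivative_def mult_commute_abs)
qed

lemma pderiv_sum: "pderiv (\<Sum>x\<in>A. f x) = (\<Sum>x\<in>A. pderiv (f x))"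
  by (induction A rule: infinite_finite_induct) (auto simp: pderiv_add)

lemma poly_pderiv_on_line: "poly (pderiv (on_line z p)) t = (\<Sum>m\<in>Poly_Mapping.keys p.
   of_nat (\<Sum>i\<in>UNIV. Poly_Mapping.lookup m i) * (Poly_Mapping.lookup p m * monom_at z m)
     * t ^ ((\<Sum>i\<in>UNIV. Poly_Mapping.lookup m i) - 1))"
  by (simp add: on_line_def pderiv_sum pderiv_monom poly_sum poly_monom)

text \<open>
  Near each zero \<open>w x(s\<^sub>0)\<close> of \<open>a\<close> on the line through \<open>x(s\<^sub>0)\<close>, the function \<open>f\<close> extends holomorphically to an open
  set. The roots for \<open>s\<close> near \<open>s\<^sub>0\<close> stay in small disjoint discs around the roots \<open>w\<close> for \<open>s\<^sub>0\<close>: they are bounded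
  by assumption, and on the compact rest of the bounded region the polynomial remains nonzero. So the part of the
  sum belonging to one disc is a contour integral that depends holomorphically on \<open>s\<close>.
\<close>

lemma root_sum_locally_holomorphic:
  fixes a :: "'n::finite mpoly" and x :: "complex \<Rightarrow> complex ^ 'n" and f :: "complex ^ 'n \<Rightarrow> complex"
    and H :: "complex poly"
  assumes f: "f \<in> Hol (zero_set a)"
    and x: "\<And>i. (\<lambda>s. x s $ i) holomorphic_on UNIV"
    and a0: "eval_mpoly a 0 \<noteq> 0"
    and bound: "\<And>s w. s \<in> ball s0 1 \<Longrightarrow> eval_mpoly a (w *s x s) = 0 \<Longrightarrow> norm w \<le> M"
  defines "S \<equiv> \<lambda>s. \<Sum>w\<in>{w. eval_mpoly a (w *s x s) = 0}. f (w *s x s) * poly H w * zorder (poly (on_line (x s) a)) w"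
  shows "\<exists>d>0. S holomorphic_on ball s0 d"
proof -
  define q where "q s = on_line (x s) a" for s
  have q: "poly (q s) w = eval_mpoly a (w *s x s)" for s w by (simp add: q_def poly_on_line)
  have q0: "q s \<noteq> 0" for s using q[of s 0] a0 by auto
  have xc: "continuous_on UNIV (\<lambda>s. x s $ i)" for i using x holomorphic_on_imp_continuous_on by blast
  have xs: "continuous_on A (\<lambda>y. x (h y) $ i)" if "continuous_on A h" for h :: "complex \<times> complex \<Rightarrow> complex" and A i
    by (rule continuous_on_compose2[OF xc that]) auto
  have sc: "continuous_on A (\<lambda>y. snd y *s x (fst y))" for A
    unfolding vector_scalar_mult_def
    by (intro continuous_on_vec_lambda continuous_intros xs)
  have mc: "continuous_on A (\<lambda>y. monom_at (x (fst y)) m)" for A :: "(complex \<times> complex) set" and m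
    unfolding monom_at_def by (intro continuous_intros xs)
  have qc: "continuous_on A (\<lambda>y. poly (q (fst y)) (snd y))" for A
    unfolding q_def on_line_def poly_sum poly_monom by (intro continuous_intros mc)
  define R where "R = {w. poly (q s0) w = 0}"
  have finR: "finite R" using poly_roots_finite[OF q0] by (simp add: R_def)
  have "\<exists>g e. 0 < e \<and> (\<exists>U. open U \<and> holomorphic_mv g U \<and> (\<forall>z\<in>U \<inter> zero_set a. g z = f z) \<and>
      (\<forall>s\<in>ball s0 e. \<forall>w\<in>ball \<rho> e. w *s x s \<in> U))" if \<rho>: "\<rho> \<in> R" for \<rho>
  proof -
    have "\<rho> *s x s0 \<in> zero_set a" using \<rho> by (simp add: R_def q zero_set_def)
    then obtain U g where U: "open U" "\<rho> *s x s0 \<in> U" "holomorphic_mv g U" "\<forall>z\<in>U \<inter> zero_set a. g z = f z"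
      using f by (auto simp: Hol_def)
    have "open ((\<lambda>y. snd y *s x (fst y)) -` U)"
      by (rule open_vimage[OF U(1) sc])
    moreover have "(s0, \<rho>) \<in> (\<lambda>y. snd y *s x (fst y)) -` U" using U by simp
    ultimately obtain A B where AB: "open A" "open B" "(s0, \<rho>) \<in> A \<times> B" "A \<times> B \<subseteq> (\<lambda>y. snd y *s x (fst y)) -` U"
      by (rule open_prod_elim)
    obtain e1 where e1: "0 < e1" "ball s0 e1 \<subseteq> A"
      using AB(1,3) open_contains_ball[of A] by auto
    obtain e2 where e2: "0 < e2" "ball \<rho> e2 \<subseteq> B"
      using AB(2,3) open_contains_ball[of B] by auto
    note e = e1 e2
    have "\<forall>s\<in>ball s0 (min e1 e2). \<forall>w\<in>ball \<rho> (min e1 e2). w *s x s \<in> U"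
    proof (intro ballI)
      fix s w assume "s \<in> ball s0 (min e1 e2)" "w \<in> ball \<rho> (min e1 e2)"
      then have "(s, w) \<in> A \<times> B" using e by auto
      then show "w *s x s \<in> U" using AB by fastforce
    qed
    then show ?thesis using U e by (intro exI[of _ g] exI[of _ "min e1 e2"]) auto
  qed
  then have "\<forall>\<rho>\<in>R. \<exists>T. case T of (g, e, U) \<Rightarrow>
      0 < e \<and> open U \<and> holomorphic_mv g U \<and> (\<forall>z\<in>U \<inter> zero_set a. g z = f z) \<and>
      (\<forall>s\<in>ball s0 e. \<forall>w\<in>ball \<rho> e. w *s x s \<in> U)"
    by (simp add: split_paired_Ex)
  from bchoice[OF this] obtain T where T: "\<forall>\<rho>\<in>R. case T \<rho> of (g, e, U) \<Rightarrow>
      0 < e \<and> open U \<and> holomorphic_mv g U \<and> (\<forall>z\<in>U \<inter> zero_set a. g z = f z) \<and>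
      (\<forall>s\<in>ball s0 e. \<forall>w\<in>ball \<rho> e. w *s x s \<in> U)" by blast
  define g where "g \<rho> = fst (T \<rho>)" for \<rho>
  define e where "e \<rho> = fst (snd (T \<rho>))" for \<rho>
  define U where "U \<rho> = snd (snd (T \<rho>))" for \<rho>
  have e: "0 < e \<rho>" and U: "open (U \<rho>)" "holomorphic_mv (g \<rho>) (U \<rho>)"
      "\<And>z. z \<in> U \<rho> \<Longrightarrow> z \<in> zero_set a \<Longrightarrow> g \<rho> z = f z"
      "\<And>s w. s \<in> ball s0 (e \<rho>) \<Longrightarrow> w \<in> ball \<rho> (e \<rho>) \<Longrightarrow> w *s x s \<in> U \<rho>" if "\<rho> \<in> R" for \<rho>
    using bspec[OF T that] by (auto simp: g_def e_def U_def case_prod_unfold)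
  \<comment> \<open>a radius for which the extensions \<open>g \<rho>\<close> are defined on all discs and the discs are disjoint\<close>
  define E where "E = Min (insert 1 (e ` R \<union> (\<lambda>(\<rho>, \<sigma>). dist \<rho> \<sigma> / 2) ` {(\<rho>, \<sigma>) \<in> R \<times> R. \<rho> \<noteq> \<sigma>}))"
  have finE: "finite (insert 1 (e ` R \<union> (\<lambda>(\<rho>, \<sigma>). dist \<rho> \<sigma> / 2) ` {(\<rho>, \<sigma>) \<in> R \<times> R. \<rho> \<noteq> \<sigma>}))"
    using finR by (auto intro: finite_subset[of _ "R \<times> R"])
  have E0: "0 < E" unfolding E_def using e by (subst Min_gr_iff[OF finE]) auto
  have E1: "E \<le> e \<rho>" if "\<rho> \<in> R" for \<rho> unfolding E_def using that by (intro Min_le[OF finE]) auto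
  have E2: "2 * E \<le> dist \<rho> \<sigma>" if "\<rho> \<in> R" "\<sigma> \<in> R" "\<rho> \<noteq> \<sigma>" for \<rho> \<sigma>
  proof -
    have "E \<le> dist \<rho> \<sigma> / 2" unfolding E_def using that by (intro Min_le[OF finE]) (auto intro!: image_eqI[of _ _ "(\<rho>, \<sigma>)"])
    then show ?thesis by simp
  qed
  define r where "r = E / 2"
  have r: "0 < r" "r < E" using E0 by (auto simp: r_def)
  \<comment> \<open>the compact region outside the discs; its radius is large enough to contain the boundary circles\<close>
  define K where "K = cball 0 (max M 0 + norm (Max (insert 0 (norm ` R))) + r) - (\<Union>\<rho>\<in>R. ball \<rho> r)"
  have "compact K" unfolding K_def by (intro compact_diff compact_cball open_UN) auto
  moreover have "open {y. poly (q (fst y)) (snd y) \<noteq> 0}"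
    using qc by (intro open_Collect_neq continuous_intros) auto
  moreover have "{s0} \<times> K \<subseteq> {y. poly (q (fst y)) (snd y) \<noteq> 0}"
    using r by (auto simp: K_def R_def)
  ultimately obtain X where X: "s0 \<in> X" "open X" "X \<times> K \<subseteq> {y. poly (q (fst y)) (snd y) \<noteq> 0}"
    using Elementary_Topology.tube_lemma[of K _ s0] by blast
  obtain d0 where d0: "0 < d0" "ball s0 d0 \<subseteq> X" using X(1,2) open_contains_ball[of X] by auto
  define d where "d = Min {d0, E, 1}"
  have d: "0 < d" "d \<le> d0" "d \<le> E" "d \<le> 1" using d0 E0 by (auto simp: d_def)
  have nzK: "poly (q s) w \<noteq> 0" if "s \<in> ball s0 d" "w \<in> K" for s w
  proof -
    have "s \<in> X" using that d d0 by auto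
    then have "(s, w) \<in> X \<times> K" using that by simp
    then show ?thesis using X(3) by auto
  qed
  have circ: "poly (q s) w \<noteq> 0" if "s \<in> ball s0 d" "\<rho> \<in> R" "dist \<rho> w = r" for s w \<rho>
  proof (rule nzK[OF that(1)])
    have "norm \<rho> \<le> Max (insert 0 (norm ` R))" using that finR by (intro Max_ge) auto
    moreover have "norm w \<le> norm \<rho> + r" using that(3) norm_triangle_ineq2[of w \<rho>] by (simp add: dist_norm norm_minus_commute)
    moreover have "w \<notin> ball \<sigma> r" if s: "\<sigma> \<in> R" for \<sigma>
    proof (cases "\<sigma> = \<rho>")
      case False
      then have "2 * E \<le> dist \<rho> \<sigma>" using E2 s \<open>\<rho> \<in> R\<close> by auto
      also have "\<dots> \<le> dist \<rho> w + dist \<sigma> w" by (rule dist_triangle2)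
      finally have "r < dist \<sigma> w" using \<open>dist \<rho> w = r\<close> r by linarith
      then show ?thesis by simp
    qed (use \<open>dist \<rho> w = r\<close> in simp)
    ultimately show "w \<in> K" by (auto simp: K_def)
  qed
  have loc: "\<exists>\<rho>\<in>R. w \<in> ball \<rho> r" if "s \<in> ball s0 d" "poly (q s) w = 0" for s w
  proof (rule ccontr)
    assume "\<not> ?thesis"
    moreover have "norm w \<le> M" using bound[of s w] that d q by auto
    moreover have "0 \<le> norm (Max (insert 0 (norm ` R)))" by simp
    ultimately have "w \<in> K" using r by (auto simp: K_def simp del: norm_ge_zero)
    then show False using nzK that by blast
  qed
  define \<Phi> where "\<Phi> \<rho> s w = poly (pderiv (q s)) w * (g \<rho> (w *s x s) * poly H w) / poly (q s) w" for \<rho> s w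
  have S_eq: "S s = (\<Sum>\<rho>\<in>R. contour_integral (circlepath \<rho> r) (\<Phi> \<rho> s) / (2 * pi * \<i>))" if s: "s \<in> ball s0 d" for s
  proof -
    let ?Z = "\<lambda>\<rho>. {w. poly (q s) w = 0 \<and> w \<in> ball \<rho> r}"
    have un: "{w. eval_mpoly a (w *s x s) = 0} = (\<Union>\<rho>\<in>R. ?Z \<rho>)" using loc[OF s] by (auto simp: q)
    have "S s = (\<Sum>\<rho>\<in>R. \<Sum>w\<in>?Z \<rho>. f (w *s x s) * poly H w * zorder (poly (q s)) w)"
      unfolding S_def un q_def[symmetric]
    proof (rule sum.UNION_disjoint[OF finR])
      show "\<forall>\<rho>\<in>R. finite (?Z \<rho>)" using poly_roots_finite[OF q0[of s]] by auto
      show "\<forall>\<rho>\<in>R. \<forall>\<sigma>\<in>R. \<rho> \<noteq> \<sigma> \<longrightarrow> ?Z \<rho> \<inter> ?Z \<sigma> = {}"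
      proof (intro ballI impI)
        fix \<rho> \<sigma> assume "\<rho> \<in> R" "\<sigma> \<in> R" "\<rho> \<noteq> \<sigma>"
        then have "2 * E \<le> dist \<rho> \<sigma>" using E2 by auto
        then have "ball \<rho> r \<inter> ball \<sigma> r = {}" using r by (intro disjoint_ballI) auto
        then show "?Z \<rho> \<inter> ?Z \<sigma> = {}" by auto
      qed
    qed
    also have "\<dots> = (\<Sum>\<rho>\<in>R. contour_integral (circlepath \<rho> r) (\<Phi> \<rho> s) / (2 * pi * \<i>))"
    proof (rule sum.cong)
      fix \<rho> assume \<rho>: "\<rho> \<in> R"
      have inU: "w *s x s \<in> U \<rho>" if "w \<in> ball \<rho> E" for w
        using U(4)[OF \<rho>, of s w] s d E1[OF \<rho>] that by auto
      have "(\<lambda>w. g \<rho> (w *s x s) * poly H w) holomorphic_on ball \<rho> E"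
        by (intro holomorphic_intros holomorphic_mv_compose[OF U(2)[OF \<rho>]])
          (auto intro!: holomorphic_intros inU)
      from contour_integral_weighted_roots[OF r q0 this circ[OF s \<rho>]]
      have "contour_integral (circlepath \<rho> r) (\<Phi> \<rho> s) = 2 * pi * \<i> * (\<Sum>w\<in>?Z \<rho>. g \<rho> (w *s x s) * poly H w * zorder (poly (q s)) w)"
        by (simp add: \<Phi>_def[abs_def])
      moreover have "(\<Sum>w\<in>?Z \<rho>. g \<rho> (w *s x s) * poly H w * zorder (poly (q s)) w)
          = (\<Sum>w\<in>?Z \<rho>. f (w *s x s) * poly H w * zorder (poly (q s)) w)"
      proof (rule sum.cong)
        fix w assume w: "w \<in> ?Z \<rho>"
        then have "w *s x s \<in> zero_set a" by (simp add: q zero_set_def)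
        moreover have "w *s x s \<in> U \<rho>" using inU w r by auto
        ultimately show "g \<rho> (w *s x s) * poly H w * zorder (poly (q s)) w = f (w *s x s) * poly H w * zorder (poly (q s)) w"
          using U(3)[OF \<rho>] by simp
      qed simp
      ultimately show "(\<Sum>w\<in>?Z \<rho>. f (w *s x s) * poly H w * zorder (poly (q s)) w)
          = contour_integral (circlepath \<rho> r) (\<Phi> \<rho> s) / (2 * pi * \<i>)" by simp
    qed simp
    finally show ?thesis .
  qed
  have "(\<lambda>s. contour_integral (circlepath \<rho> r) (\<Phi> \<rho> s)) holomorphic_on ball s0 d" if \<rho>: "\<rho> \<in> R" for \<rho>
  proof (rule holomorphic_on_contour_integral_param)
    have pi: "path_image (circlepath \<rho> r) = sphere \<rho> r" using r by simp
    have inU: "w *s x s \<in> U \<rho>" if "s \<in> ball s0 d" "dist \<rho> w = r" for s w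
      using U(4)[OF \<rho>, of s w] that d E1[OF \<rho>] r by auto
    have gc: "continuous_on (ball s0 d \<times> sphere \<rho> r) (\<lambda>y. g \<rho> (snd y *s x (fst y)))"
      by (rule continuous_on_compose2[OF holomorphic_mv_continuous_on[OF U(2)[OF \<rho>]] sc]) (auto intro: inU)
    have pc: "continuous_on A (\<lambda>y. poly (pderiv (q (fst y))) (snd y))" for A
      unfolding q_def poly_pderiv_on_line by (intro continuous_intros mc)
    show "continuous_on (ball s0 d \<times> path_image (circlepath \<rho> r)) (\<lambda>(s, w). \<Phi> \<rho> s w)"
      unfolding pi \<Phi>_def case_prod_unfold
      by (intro continuous_intros gc pc qc) (use circ[OF _ \<rho>] in auto)
    show "continuous_on {0..1} (\<lambda>t. vector_derivative (circlepath \<rho> r) (at t))"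
      unfolding vector_derivative_circlepath by (intro continuous_intros)
    fix w assume "w \<in> path_image (circlepath \<rho> r)"
    then have w: "dist \<rho> w = r" using r by (simp add: pi)
    have xh: "(\<lambda>s. x s $ i) holomorphic_on ball s0 d" for i using x holomorphic_on_subset by blast
    have mh: "(\<lambda>s. monom_at (x s) m) holomorphic_on ball s0 d" for m
      unfolding monom_at_def by (intro holomorphic_intros xh)
    have "(\<lambda>s. poly (q s) w) holomorphic_on ball s0 d"
      unfolding q_def on_line_def poly_sum poly_monom by (intro holomorphic_intros mh)
    moreover have "(\<lambda>s. poly (pderiv (q s)) w) holomorphic_on ball s0 d"
      unfolding q_def poly_pderiv_on_line by (intro holomorphic_intros mh)
    moreover have "(\<lambda>s. g \<rho> (w *s x s)) holomorphic_on ball s0 d"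
      by (rule holomorphic_mv_compose[OF U(2)[OF \<rho>]]) (auto intro!: holomorphic_intros xh inU w)
    ultimately show "(\<lambda>s. \<Phi> \<rho> s w) holomorphic_on ball s0 d"
      unfolding \<Phi>_def by (intro holomorphic_intros) (use circ[OF _ \<rho> w] in auto)
  qed auto
  then have "(\<lambda>s. \<Sum>\<rho>\<in>R. contour_integral (circlepath \<rho> r) (\<Phi> \<rho> s) / (2 * pi * \<i>)) holomorphic_on ball s0 d"
    by (intro holomorphic_intros) auto
  then have "S holomorphic_on ball s0 d"
    by (rule holomorphic_transform) (simp add: S_eq)
  then show ?thesis using d by blast
qed

text \<open>
  Both \<open>z\<close> and its mirror image \<open>1 / cnj z\<close> are zeros of \<open>a\<close>, so neither lies in the polydisc.
\<close>

lemma self_reflective_root_bounds: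
  fixes a :: "'n::finite mpoly"
  assumes a: "self_reflective a" and zf: "\<And>z. z \<in> polydisc \<Longrightarrow> eval_mpoly a z \<noteq> 0"
    and z: "\<And>i. z $ i \<noteq> 0" "eval_mpoly a z = 0"
  shows "\<exists>i. norm (z $ i) \<le> 1" "\<exists>i. norm (z $ i) \<ge> 1"
proof -
  have "z \<notin> polydisc" using zf z by blast
  then show "\<exists>i. norm (z $ i) \<ge> 1" by (auto simp: polydisc_def not_less)
  obtain c where "reflection a = const_mpoly c * a" using a by (auto simp: self_reflective_def)
  then have "eval_mpoly (reflection a) z = 0" using z by (simp add: eval_mpoly_mult)
  then have "eval_mpoly a (\<chi> i. 1 / cnj (z $ i)) = 0"
    using eval_reflection[of z a] z by (simp add: monom_at_eq_0_iff)
  then have "(\<chi> i. 1 / cnj (z $ i)) \<notin> polydisc" using zf by blast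
  then obtain i where "1 \<le> norm (1 / cnj (z $ i))" by (auto simp: polydisc_def not_less)
  then have "norm (z $ i) \<le> 1" using z(1)[of i] by (simp add: norm_divide le_divide_eq)
  then show "\<exists>i. norm (z $ i) \<le> 1" by blast
qed

lemma zorder_poly_root:
  assumes "Q \<noteq> 0" "poly Q w = (0 :: complex)"
  shows "zorder (poly Q) w > 0"
proof -
  have hol: "poly Q holomorphic_on UNIV"
    by (auto simp: holomorphic_on_open intro: poly_DERIV)
  have "\<exists>v\<in>UNIV. poly Q v \<noteq> 0" using assms(1) poly_all_0_iff_0 by blast
  then show ?thesis
    using zorder_exist_zero[of "poly Q" UNIV w, OF _ open_UNIV connected_UNIV UNIV_I] assms(2)
      hol by auto
qed

text \<open>
  The curve \<open>x\<close> is chosen with coordinates \<open>exp (\<i> \<theta>\<^sub>i + s \<rho>\<^sub>i)\<close>, where \<open>exp (\<rho>\<^sub>i + \<i> \<theta>\<^sub>i)\<close> is the coordinate \<open>i\<close> of \<open>z\<close>. It passes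
  through \<open>z\<close> at \<open>s = 1\<close>, maps the imaginary axis to the torus and avoids the coordinate hyperplanes.
  The latter makes the root bounds applicable, which keep the roots from escaping to infinity, so the
  weighted sum \<open>S\<close> of the values of \<open>f\<close> over the roots is entire. It is zero on the imaginary axis, hence everywhere.
\<close>

lemma vanishing_off_coordinate_hyperplanes:
  fixes a :: "'n::finite mpoly"
  assumes a: "self_reflective a" and zf: "\<And>z. z \<in> polydisc \<Longrightarrow> eval_mpoly a z \<noteq> 0"
    and f: "f \<in> Hol (zero_set a)" and van: "\<And>z. z \<in> torus \<Longrightarrow> z \<in> zero_set a \<Longrightarrow> f z = 0"
    and z: "z \<in> zero_set a" "\<And>i. z $ i \<noteq> 0"
  shows "f z = 0"
proof -
  have a0: "eval_mpoly a 0 \<noteq> 0" using zf by (simp add: polydisc_def)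
  define x where "x s = (\<chi> i. exp (\<i> * of_real (Im (Ln (z $ i))) + s * of_real (Re (Ln (z $ i)))))" for s :: complex
  have xnz: "x s $ i \<noteq> 0" for s i by (simp add: x_def)
  have xh: "(\<lambda>s. x s $ i) holomorphic_on UNIV" for i
    unfolding x_def by (auto intro!: holomorphic_intros)
  have x1: "x 1 = z"
  proof -
    have "\<i> * of_real (Im (Ln (z $ i))) + 1 * of_real (Re (Ln (z $ i))) = Ln (z $ i)" for i
      by (simp add: complex_eq_iff)
    then show ?thesis using z(2) by (simp add: x_def vec_eq_iff del: mult_1)
  qed
  have xt: "x s \<in> torus" if "Re s = 0" for s
    using that by (auto simp: torus_def x_def)
  define q where "q s = on_line (x s) a" for s
  have q: "poly (q s) w = eval_mpoly a (w *s x s)" for s w by (simp add: q_def poly_on_line)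
  have q0: "q s \<noteq> 0" for s using q[of s 0] a0 by auto
  \<comment> \<open>the weight vanishes at all roots for \<open>s = 1\<close> except at the root 1, which belongs to the point \<open>z\<close>\<close>
  define H where "H = (\<Prod>w\<in>{w. poly (q 1) w = 0} - {1}. [:- w, 1:])"
  have fin: "finite {w. poly (q 1) w = 0}" using poly_roots_finite q0 by blast
  have H1: "poly H 1 \<noteq> 0" using fin by (auto simp: H_def poly_prod)
  have H0: "poly H w = 0" if "poly (q 1) w = 0" "w \<noteq> 1" for w
    using that fin by (auto simp: H_def poly_prod)
  define S where "S s = (\<Sum>w\<in>{w. eval_mpoly a (w *s x s) = 0}. f (w *s x s) * poly H w * zorder (poly (on_line (x s) a)) w)" for s
  have "\<exists>d>0. S holomorphic_on ball s0 d" for s0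
  proof -
    \<comment> \<open>a root \<open>w\<close> satisfies \<open>|w x\<^sub>i(s)| \<le> 1\<close> for some \<open>i\<close>, so a bound for all \<open>1 / |x\<^sub>i(s)|\<close> bounds the roots\<close>
    have "compact ((\<lambda>s. \<Sum>i\<in>UNIV. norm (1 / x s $ i)) ` cball s0 1)"
      using xnz by (intro compact_continuous_image continuous_intros holomorphic_on_imp_continuous_on[OF holomorphic_on_subset[OF xh]]) auto
    then obtain M where M: "\<And>s. s \<in> cball s0 1 \<Longrightarrow> norm (\<Sum>i\<in>UNIV. norm (1 / x s $ i)) \<le> M"
      by (meson bounded_iff compact_imp_bounded imageI)
    have "norm w \<le> M" if s: "s \<in> ball s0 1" and w: "eval_mpoly a (w *s x s) = 0" for s w
    proof -
      have "w \<noteq> 0" using w a0 by auto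
      then obtain i where "norm ((w *s x s) $ i) \<le> 1"
        using self_reflective_root_bounds(1)[OF a zf _ w] xnz by auto
      then have "norm w \<le> norm (1 / x s $ i)" using xnz[of s i] by (simp add: norm_mult norm_divide le_divide_eq)
      also have "\<dots> \<le> (\<Sum>i\<in>UNIV. norm (1 / x s $ i))" by (rule member_le_sum) auto
      also have "\<dots> \<le> M" using M[of s] s by (simp add: abs_le_iff)
      finally show ?thesis .
    qed
    then show ?thesis
      using root_sum_locally_holomorphic[OF f xh a0, of s0 M H] unfolding S_def[abs_def] by blast
  qed
  then have "S field_differentiable (at s0)" for s0
    by (metis centre_in_ball holomorphic_on_imp_differentiable_at open_ball)
  then have Sh: "S holomorphic_on UNIV" by (simp add: holomorphic_on_def)
  have imag: "S s = 0" if s: "Re s = 0" for s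
  proof -
    have "f (w *s x s) = 0" if w: "eval_mpoly a (w *s x s) = 0" for w
    proof (rule van)
      have "w \<noteq> 0" using w a0 by auto
      have "norm ((w *s x s) $ i) = norm w" for i
        using xt[OF s] by (simp add: torus_def norm_mult)
      then have "norm w = 1"
        using self_reflective_root_bounds[OF a zf _ w] xnz \<open>w \<noteq> 0\<close> by force
      then show "w *s x s \<in> torus" using xt[OF s] by (auto simp: torus_def norm_mult)
      show "w *s x s \<in> zero_set a" using w by (simp add: zero_set_def)
    qed
    then show ?thesis unfolding S_def by (intro sum.neutral) auto
  qed
  have "S 1 = 0"
  proof (rule analytic_continuation[OF Sh open_UNIV connected_UNIV, of "{s. Re s = 0}" 0])
    show "0 islimpt {s. Re s = 0}"
      unfolding islimpt_approachable
    proof (intro allI impI)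
      fix e :: real assume "0 < e"
      then show "\<exists>x'\<in>{s. Re s = 0}. x' \<noteq> 0 \<and> dist x' 0 < e"
        by (intro bexI[of _ "\<i> * of_real (e / 2)"]) (auto simp: norm_mult)
    qed
  qed (use imag in auto)
  moreover have "S 1 = f z * poly H 1 * zorder (poly (q 1)) 1"
  proof -
    have r1: "1 \<in> {w. eval_mpoly a (w *s x 1) = 0}" using z(1) by (simp add: x1 zero_set_def)
    have "S 1 = f (1 *s x 1) * poly H 1 * zorder (poly (q 1)) 1
      + (\<Sum>w\<in>{w. eval_mpoly a (w *s x 1) = 0} - {1}. f (w *s x 1) * poly H w * zorder (poly (q 1)) w)"
      unfolding S_def q_def[symmetric] by (rule sum.remove[OF _ r1]) (use fin q in simp)
    moreover have "(\<Sum>w\<in>{w. eval_mpoly a (w *s x 1) = 0} - {1}. f (w *s x 1) * poly H w * zorder (poly (q 1)) w) = 0"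
      by (rule sum.neutral) (use H0 q in auto)
    ultimately show ?thesis by (simp add: x1)
  qed
  moreover have "zorder (poly (q 1)) 1 \<noteq> 0"
    using zorder_poly_root[OF q0, of 1 1] z(1) by (simp add: q x1 zero_set_def)
  ultimately show ?thesis using H1 by simp
qed

section \<open>Self-reflective polynomials without zeros in the polydisc are toral\<close>

text \<open>
  Apart from the factor \<open>poly P 0\<close>, the value of \<open>P\<close> at 1 is the product of the numbers \<open>1 - 1/\<rho>\<close> over all roots \<open>\<rho>\<close>.
\<close>

lemma small_value_imp_root_near_one:
  fixes P :: "complex poly"
  assumes "0 < \<eta>" "norm (poly P 1) < norm (poly P 0) * \<eta> ^ degree P"
  shows "\<exists>\<rho>. \<rho> \<noteq> 0 \<and> poly P \<rho> = 0 \<and> norm (1 - 1 / \<rho>) < \<eta>"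
  using assms(2)
proof (induction "degree P" arbitrary: P)
  case 0
  then obtain c where "P = [:c:]" by (metis degree_eq_zeroE)
  then show ?case using 0 by simp
next
  case (Suc n)
  then have "\<not> constant (poly P)" by (simp add: constant_degree)
  then obtain \<rho> where \<rho>: "poly P \<rho> = 0" using Fundamental_Theorem_Algebra.fundamental_theorem_of_algebra[of P] by auto
  then obtain T where T: "P = [:- \<rho>, 1:] * T" by (auto simp: poly_eq_0_iff_dvd dvd_def)
  have "P \<noteq> 0" using Suc.hyps(2) by auto
  then have "T \<noteq> 0" using T by auto
  have d: "degree P = Suc (degree T)" unfolding T using \<open>T \<noteq> 0\<close> by (subst degree_mult_eq) auto
  have "poly P 0 \<noteq> 0" using Suc.prems by auto
  then have "\<rho> \<noteq> 0" using \<rho> by auto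
  show ?case
  proof (cases "norm (1 - 1 / \<rho>) < \<eta>")
    case True
    then show ?thesis using \<rho> \<open>\<rho> \<noteq> 0\<close> by blast
  next
    case False
    have "(1 - 1 / \<rho>) * \<rho> = \<rho> - 1" using \<open>\<rho> \<noteq> 0\<close>
      by (simp add: left_diff_distrib)
    then have "norm (1 - \<rho>) = norm (1 - 1 / \<rho>) * norm \<rho>"
      by (metis norm_mult norm_minus_commute)
    then have ge: "norm \<rho> * \<eta> \<le> norm (1 - \<rho>)" using False
      by (simp add: mult.commute[of "norm (1 - 1 / \<rho>)"] mult_left_mono)
    have "norm \<rho> * \<eta> * norm (poly T 1) \<le> norm (1 - \<rho>) * norm (poly T 1)"
      using ge by (rule mult_right_mono) simp
    also have "\<dots> = norm (poly P 1)" by (simp add: T norm_mult[symmetric] algebra_simps)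
    also have "\<dots> < norm (poly P 0) * \<eta> ^ degree P" by (rule Suc.prems)
    also have "\<dots> = norm \<rho> * \<eta> * (norm (poly T 0) * \<eta> ^ degree T)" unfolding d by (simp add: T norm_mult)
    finally have "norm (poly T 1) < norm (poly T 0) * \<eta> ^ degree T"
      using \<open>\<rho> \<noteq> 0\<close> assms(1) by (simp add: mult_less_cancel_left)
    then obtain \<sigma> where "\<sigma> \<noteq> 0" "poly T \<sigma> = 0" "norm (1 - 1 / \<sigma>) < \<eta>"
      using Suc.hyps(1)[of T] Suc.hyps(2) d by auto
    then show ?thesis by (intro exI[of _ \<sigma>]) (simp add: T)
  qed
qed

lemma degree_on_line_le:
  assumes "\<And>m. m \<in> Poly_Mapping.keys p \<Longrightarrow> (\<Sum>i\<in>UNIV. Poly_Mapping.lookup m i) \<le> N"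
  shows "degree (on_line z p) \<le> N"
  unfolding on_line_def
  by (rule degree_sum_le) (auto intro: order.trans[OF degree_monom_le assms])

text \<open>
  Zeros with some vanishing coordinates are limits of zeros off the coordinate hyperplanes. To see this, replace the
  vanishing coordinates of \<open>z0\<close> by a small number \<open>t\<close>. Along the line through the resulting point \<open>zt t\<close>, the
  polynomial \<open>a\<close> is small at 1 compared to its value at 0, so it has a root near 1.
\<close>

theorem self_reflective_imp_toral:
  fixes a :: "'n::finite mpoly"
  assumes a: "self_reflective a" and zf: "\<And>z. z \<in> polydisc \<Longrightarrow> eval_mpoly a z \<noteq> 0"
  shows "toral a"
  unfolding toral_def toral_set_def determining_def
proof (intro conjI ballI impI)
  fix f z0
  assume f: "f \<in> Hol (zero_set a)" and van: "\<forall>z\<in>torus \<inter> zero_set a. f z = 0" and z0: "z0 \<in> zero_set a"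
  have off: "f z = 0" if "z \<in> zero_set a" "\<And>i. z $ i \<noteq> 0" for z
    by (rule vanishing_off_coordinate_hyperplanes[OF a zf f]) (use van that in auto)
  have a0: "eval_mpoly a 0 \<noteq> 0" using zf by (simp add: polydisc_def)
  obtain U g where U: "open U" "z0 \<in> U" "holomorphic_mv g U" "\<And>z. z \<in> U \<Longrightarrow> z \<in> zero_set a \<Longrightarrow> g z = f z"
    using f z0 by (auto simp: Hol_def)
  show "f z0 = 0"
  proof (rule ccontr)
    assume "f z0 \<noteq> 0"
    then have "g z0 \<noteq> 0" using U z0 by simp
    define V where "V = {z \<in> U. g z \<noteq> 0}"
    have "open V"
    proof -
      have "V = U \<inter> g -` (- {0})" by (auto simp: V_def)
      then show ?thesis using holomorphic_mv_continuous_on[OF U(3)] U(1)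
        by (simp add: continuous_on_open_vimage[OF U(1)] Int_commute open_Compl)
    qed
    have "z0 \<in> V" using U \<open>g z0 \<noteq> 0\<close> by (simp add: V_def)
    define zt where "zt t = (\<chi> i. if z0 $ i = 0 then t else z0 $ i)" for t :: complex
    have zt0: "zt 0 = z0" by (auto simp: zt_def vec_eq_iff)
    have ztc: "continuous_on A (\<lambda>y. zt (h y))" if "continuous_on A h" for A :: "'b::topological_space set" and h
      unfolding zt_def
    proof (rule continuous_on_vec_lambda)
      show "continuous_on A (\<lambda>y. if z0 $ i = 0 then h y else z0 $ i)" for i
        using that by (cases "z0 $ i = 0") auto
    qed
    \<comment> \<open>a root \<open>\<rho>\<close> enters through \<open>1 - 1/\<rho>\<close>, the quantity that is shown to be small\<close>
    define \<psi> where "\<psi> y = (1 / (1 - fst y)) *s zt (snd y)" for y :: "complex \<times> complex"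
    have "continuous_on A (\<lambda>y. zt (snd y))" for A :: "(complex \<times> complex) set"
      by (intro continuous_intros ztc)
    then have "continuous_on {y. fst y \<noteq> 1} \<psi>"
      unfolding \<psi>_def vector_scalar_mult_def
      by (intro continuous_on_vec_lambda continuous_intros) auto
    moreover have "open {y :: complex \<times> complex. fst y \<noteq> 1}"
      by (intro open_Collect_neq continuous_intros)
    ultimately have "open (\<psi> -` V \<inter> {y. fst y \<noteq> 1})"
      using continuous_on_open_vimage \<open>open V\<close> by blast
    moreover have "(0, 0) \<in> \<psi> -` V \<inter> {y. fst y \<noteq> 1}" using \<open>z0 \<in> V\<close> by (simp add: \<psi>_def zt0)
    ultimately obtain A B where AB: "open A" "open B" "(0, 0) \<in> A \<times> B" "A \<times> B \<subseteq> \<psi> -` V \<inter> {y. fst y \<noteq> 1}"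
      by (rule open_prod_elim)
    obtain \<eta> where \<eta>: "0 < \<eta>" "ball 0 \<eta> \<subseteq> A" using AB(1,3) open_contains_ball[of A] by auto
    obtain \<tau> where \<tau>: "0 < \<tau>" "ball 0 \<tau> \<subseteq> B" using AB(2,3) open_contains_ball[of B] by auto
    define N where "N = Max (insert 0 ((\<lambda>m. \<Sum>i\<in>UNIV. Poly_Mapping.lookup m i) ` Poly_Mapping.keys a))"
    have N: "degree (on_line z a) \<le> N" for z
      unfolding N_def by (rule degree_on_line_le) (intro Max_ge; auto)
    define \<eta>' where "\<eta>' = min \<eta> 1"
    have "continuous_on UNIV (\<lambda>t. eval_mpoly a (zt t))"
      by (rule continuous_on_compose2[OF holomorphic_mv_continuous_on[OF holomorphic_mv_eval[of a UNIV]] ztc]) auto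
    then have "open ((\<lambda>t. norm (eval_mpoly a (zt t))) -` {..< norm (eval_mpoly a 0) * \<eta>' ^ N})"
      by (intro open_vimage continuous_intros) auto
    moreover have "0 \<in> (\<lambda>t. norm (eval_mpoly a (zt t))) -` {..< norm (eval_mpoly a 0) * \<eta>' ^ N}"
      using z0 a0 \<eta> by (simp add: zt0 zero_set_def \<eta>'_def)
    ultimately obtain \<delta> where \<delta>: "0 < \<delta>" "ball 0 \<delta> \<subseteq> (\<lambda>t. norm (eval_mpoly a (zt t))) -` {..< norm (eval_mpoly a 0) * \<eta>' ^ N}"
      by (meson open_contains_ball)
    define t where "t = (of_real (min \<delta> \<tau> / 2) :: complex)"
    have t: "t \<noteq> 0" "t \<in> ball 0 \<delta>" "t \<in> ball 0 \<tau>" using \<delta> \<tau> by (auto simp: t_def)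
    have "norm (eval_mpoly a (zt t)) < norm (eval_mpoly a 0) * \<eta>' ^ N" using t \<delta> by auto
    also have "\<dots> \<le> norm (eval_mpoly a 0) * \<eta>' ^ degree (on_line (zt t) a)"
      using N[of "zt t"] \<eta> by (intro mult_left_mono power_decreasing) (auto simp: \<eta>'_def)
    finally have "norm (poly (on_line (zt t) a) 1) < norm (poly (on_line (zt t) a) 0) * \<eta>' ^ degree (on_line (zt t) a)"
      by (simp add: poly_on_line)
    then obtain \<rho> where \<rho>: "\<rho> \<noteq> 0" "poly (on_line (zt t) a) \<rho> = 0" "norm (1 - 1 / \<rho>) < \<eta>'"
      using small_value_imp_root_near_one[of \<eta>'] \<eta> by (auto simp: \<eta>'_def)
    have "(1 - 1 / \<rho>, t) \<in> A \<times> B" using \<rho>(3) t \<eta> \<tau> by (auto simp: \<eta>'_def)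
    then have "\<psi> (1 - 1 / \<rho>, t) \<in> V" using AB(4) by auto
    then have "\<rho> *s zt t \<in> V" by (simp add: \<psi>_def)
    moreover have "\<rho> *s zt t \<in> zero_set a" using \<rho> by (simp add: poly_on_line zero_set_def)
    moreover have "f (\<rho> *s zt t) = 0"
      by (rule off) (use calculation \<rho> t in \<open>auto simp: zt_def\<close>)
    ultimately show False using U by (auto simp: V_def)
  qed
qed simp

section \<open>Essentially equal rational inner functions\<close>

text \<open>
  The existence of the factorization into a toral and an atoral part, in an algebraic form: \<open>a\<close> collects the
  irreducible factors that divide their own reflection.
\<close>

lemma self_reflective_decomposition:
  fixes p :: "'n::finite mpoly"
  assumes "p \<noteq> 0"
  shows "\<exists>a b. p = a * b \<and> self_reflective a \<and> (\<forall>r. irreducible r \<longrightarrow> r dvd b \<longrightarrow> \<not> r dvd reflection r)"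
  using assms
proof (induction p rule: factor_induct)
  case (unit c)
  have "\<not> r dvd 1" if "irreducible r" for r :: "'n mpoly" using that by (simp add: irreducible_def)
  then show ?case using self_reflective_const[OF unit] by (intro exI[of _ "const_mpoly c"] exI[of _ 1]) auto
next
  case (factor r p)
  then obtain a b where ab: "p = a * b" "self_reflective a"
    "\<And>r. irreducible r \<Longrightarrow> r dvd b \<Longrightarrow> \<not> r dvd reflection r" by blast
  have r0: "r \<noteq> 0" "\<not> r dvd 1" using factor.hyps by (auto simp: irreducible_def)
  show ?case
  proof (cases "r dvd reflection r")
    case True
    then have "self_reflective (r * a)"
      using self_reflective_mult self_reflective_if_dvd_reflection r0 ab(2) by blast
    then show ?thesis using ab by (intro exI[of _ "r * a"] exI[of _ b]) (auto simp: mult_ac)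
  next
    case False
    have "\<not> s dvd reflection s" if s: "irreducible s" "s dvd r * b" for s
    proof
      assume sr: "s dvd reflection s"
      have "s dvd r \<or> s dvd b" by (rule irreducible_mpoly_dvd_multD[OF s])
      then have "s dvd r" using ab(3)[OF s(1)] sr by blast
      then obtain u where u: "r = s * u" by (auto simp: dvd_def)
      have s0: "s \<noteq> 0" "\<not> s dvd 1" using s by (auto simp: irreducible_def)
      then have "u dvd 1" using factor.hyps(1) u by (auto simp: irreducible_def)
      then obtain c where "c \<noteq> 0" "u = const_mpoly c" by (auto simp: unit_iff)
      then have "self_reflective r"
        using u self_reflective_mult self_reflective_const self_reflective_if_dvd_reflection[OF sr s0(1)] by blast
      then show False using False self_reflective_dvd by blast
    qed
    then show ?thesis using ab by (intro exI[of _ a] exI[of _ "r * b"]) (auto simp: mult_ac)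
  qed
qed

lemma zero_free_dvd:
  "q dvd p \<Longrightarrow> eval_mpoly p z \<noteq> 0 \<Longrightarrow> eval_mpoly q z \<noteq> 0"
  by (auto simp: dvd_def eval_mpoly_mult)

text \<open>
  An irreducible factor \<open>r\<close> of \<open>b\<close> cannot divide the reflection of \<open>b\<close>: otherwise the reflection of \<open>r\<close> would
  divide \<open>b\<close> and have no zeros in the polydisc, making \<open>r\<close> self-reflective. So it divides \<open>b'\<close>, can be
  cancelled on both sides, and induction applies.
\<close>

lemma dvd_if_reflection_quotients_proportional:
  fixes b b' :: "'n::finite mpoly"
  assumes "b \<noteq> 0" "\<And>z. z \<in> polydisc \<Longrightarrow> eval_mpoly b z \<noteq> 0"
    and "\<And>r. irreducible r \<Longrightarrow> r dvd b \<Longrightarrow> \<not> r dvd reflection r"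
    and "reflection b * b' = const_mpoly k * (reflection b' * b)"
  shows "b dvd b'"
  using assms
proof (induction b arbitrary: b' rule: factor_induct)
  case (unit c)
  have "const_mpoly c dvd (1 :: 'n mpoly)" using unit by (auto simp: unit_iff)
  then show ?case by (metis dvd_trans one_dvd)
next
  case (factor r p)
  have zf: "eval_mpoly (r * p) z \<noteq> 0" if "z \<in> polydisc" for z by (rule factor.prems(1)[OF that])
  have zr: "eval_mpoly r z \<noteq> 0" if "z \<in> polydisc" for z using zf[OF that] by (simp add: eval_mpoly_mult)
  have zp: "eval_mpoly p z \<noteq> 0" if "z \<in> polydisc" for z using zf[OF that] by (simp add: eval_mpoly_mult)
  have r0: "r \<noteq> 0" using factor.hyps by (auto simp: irreducible_def)
  have nr: "\<not> r dvd reflection r" using factor.prems(2)[OF factor.hyps(1)] by simp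
  have "r dvd reflection (r * p) * b'" unfolding factor.prems(3) by simp
  then have "r dvd reflection (r * p) \<or> r dvd b'" by (rule irreducible_mpoly_dvd_multD[OF factor.hyps(1)])
  moreover have "\<not> r dvd reflection (r * p)"
  proof
    assume "r dvd reflection (r * p)"
    then obtain m where "reflection (r * p) = r * m" by (auto simp: dvd_def)
    then have "reflection (reflection (r * p)) = reflection r * reflection m" by (simp add: reflection_mult)
    moreover have "eval_mpoly (r * p) 0 \<noteq> 0" using zf by (simp add: polydisc_def)
    ultimately have "reflection r dvd r * p" using reflection_reflection[of "r * p"] by simp
    then have "eval_mpoly (reflection r) z \<noteq> 0" if "z \<in> polydisc" for z
      using zero_free_dvd zf[OF that] by blast
    then have "self_reflective r" using zero_free_reflection_imp_self_reflective zr by blast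
    then show False using nr self_reflective_dvd by blast
  qed
  ultimately obtain b1 where b1: "b' = r * b1" by (auto simp: dvd_def)
  have "(reflection r * r) * (reflection p * b1) = (reflection r * r) * (const_mpoly k * (reflection b1 * p))"
    using factor.prems(3) by (simp add: b1 reflection_mult mult_ac)
  then have "reflection p * b1 = const_mpoly k * (reflection b1 * p)"
    by (rule mpoly_mult_cancel_left) (simp add: r0)
  then have "p dvd b1"
    using factor.IH zp factor.prems(2) by (meson dvd_mult)
  then show ?case unfolding b1 by (rule mult_dvd_mono[OF dvd_refl])
qed

lemma dvd_antisym_const:
  fixes b b' :: "'n::finite mpoly"
  assumes "b dvd b'" "b' dvd b" "b \<noteq> 0"
  shows "\<exists>c. c \<noteq> 0 \<and> b' = const_mpoly c * b"
proof -
  obtain u v where u: "b' = b * u" and v: "b = b' * v" using assms by (auto simp: dvd_def)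
  have "b * (u * v) = b' * v" unfolding u by (simp only: mult.assoc)
  then have "b * 1 = b * (u * v)" using v by simp
  then have "1 = u * v" using mpoly_mult_cancel_left assms(3) by blast
  then have "u dvd 1" by (rule dvdI)
  then show ?thesis using u by (auto simp: unit_iff mult.commute)
qed

lemma reflection_monomial: "reflection (Poly_Mapping.single h 1 :: 'n::finite mpoly) = 1"
proof -
  have "multidegree (Poly_Mapping.single h 1 :: 'n mpoly) = h"
    by (rule poly_mapping_eqI) (simp add: lookup_multidegree)
  then show ?thesis by (simp add: reflection_def)
qed

lemma const_mpoly_inverse_mult: "c \<noteq> 0 \<Longrightarrow> const_mpoly (inverse c) * (const_mpoly c * p) = p"
  by (simp add: mult.assoc[symmetric] const_mpoly_mult)

theorem theorem3p1:
  fixes p q :: "'n::finite mpoly"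
    and h e :: "'n \<Rightarrow>\<^sub>0 nat"
    and \<phi> \<psi> :: "complex ^ 'n \<Rightarrow> complex"
  assumes "rational_inner_function \<phi>" and "rational_inner_function \<psi>"
    and "\<And>z. z \<in> polydisc \<Longrightarrow> eval_mpoly p z \<noteq> 0"
    and "\<And>z. z \<in> polydisc \<Longrightarrow> eval_mpoly q z \<noteq> 0"
    and "\<And>z. z \<in> polydisc \<Longrightarrow>
           \<phi> z = monom_at z h * (eval_mpoly (reflection p) z / eval_mpoly p z)"
    and "\<And>z. z \<in> polydisc \<Longrightarrow>
           \<psi> z = monom_at z e * (eval_mpoly (reflection q) z / eval_mpoly q z)"
  shows "(\<exists>c. c \<noteq> 0 \<and> (\<forall>z\<in>polydisc. \<phi> z = c * \<psi> z)) \<longleftrightarrow>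
         same_atoral_factor p q \<and> h = e"
proof
  have 0: "0 \<in> (polydisc :: (complex ^ 'n) set)" by (simp add: polydisc_def)
  have p0: "eval_mpoly p 0 \<noteq> 0" and q0: "eval_mpoly q 0 \<noteq> 0" using assms(3,4)[OF 0] by auto
  then have pnz: "p \<noteq> 0" and qnz: "q \<noteq> 0" by auto
  {
    assume "\<exists>c. c \<noteq> 0 \<and> (\<forall>z\<in>polydisc. \<phi> z = c * \<psi> z)"
    then obtain c where c: "c \<noteq> 0" "\<And>z. z \<in> polydisc \<Longrightarrow> \<phi> z = c * \<psi> z" by blast
    define X where "X m = (Poly_Mapping.single m 1 :: 'n mpoly)" for m
    have X: "eval_mpoly (X m) z = monom_at z m" for m z by (simp add: X_def eval_mpoly_single)
    have Xr: "reflection (X m) = 1" for m by (simp add: X_def reflection_monomial)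
    have Xnz: "X m \<noteq> 0" for m using Xr[of m] by auto
    have eq: "X h * (reflection p * q) = const_mpoly c * (X e * (reflection q * p))"
    proof (rule mpoly_eqI_polydisc)
      fix z :: "complex ^ 'n" assume z: "z \<in> polydisc"
      show "eval_mpoly (X h * (reflection p * q)) z = eval_mpoly (const_mpoly c * (X e * (reflection q * p))) z"
        using c(2)[OF z] assms(3-6)[OF z] by (simp add: eval_mpoly_mult X field_simps)
    qed
    \<comment> \<open>the reflection of a monomial is 1\<close>
    from arg_cong[OF eq, of reflection]
    have eq': "p * reflection q = const_mpoly (cnj c) * (q * reflection p)"
      by (simp add: reflection_mult Xr reflection_reflection p0 q0)
    have "(reflection p * q) * X h = const_mpoly c * (X e * (p * reflection q))"
      using eq by (simp add: mult_ac)
    also have "\<dots> = const_mpoly c * const_mpoly (cnj c) * X e * (reflection p * q)"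
      unfolding eq' by (simp add: mult_ac)
    also have "\<dots> = (reflection p * q) * (const_mpoly (c * cnj c) * X e)"
      by (simp add: const_mpoly_mult mult_ac)
    finally have "X h = const_mpoly (c * cnj c) * X e"
      by (rule mpoly_mult_cancel_left) (simp add: pnz qnz)
    then have "Poly_Mapping.single h 1 = Poly_Mapping.single e (c * cnj c)"
      by (simp add: X_def const_mpoly_def mult_single)
    then have "Poly_Mapping.lookup (Poly_Mapping.single e (c * cnj c)) h = 1"
      by (metis lookup_single_eq)
    then have he: "h = e" by (simp add: lookup_single when_def split: if_splits)
    have "X h * (reflection p * q) = X h * (const_mpoly c * (reflection q * p))"
      using eq by (simp add: he mult_ac)
    then have pq: "reflection p * q = const_mpoly c * (reflection q * p)"
      using mpoly_mult_cancel_left Xnz by blast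
    obtain a b where ab: "p = a * b" "self_reflective a" "\<And>r. irreducible r \<Longrightarrow> r dvd b \<Longrightarrow> \<not> r dvd reflection r"
      using self_reflective_decomposition[OF pnz] by blast
    obtain a' b' where ab': "q = a' * b'" "self_reflective a'" "\<And>r. irreducible r \<Longrightarrow> r dvd b' \<Longrightarrow> \<not> r dvd reflection r"
      using self_reflective_decomposition[OF qnz] by blast
    have nz: "a \<noteq> 0" "b \<noteq> 0" "a' \<noteq> 0" "b' \<noteq> 0" using ab ab' pnz qnz by auto
    obtain u where u: "u \<noteq> 0" "reflection a = const_mpoly u * a" using ab(2) by (auto simp: self_reflective_def)
    obtain u' where u': "u' \<noteq> 0" "reflection a' = const_mpoly u' * a'" using ab'(2) by (auto simp: self_reflective_def)
    have zf: "eval_mpoly a z \<noteq> 0" "eval_mpoly b z \<noteq> 0" "eval_mpoly a' z \<noteq> 0" "eval_mpoly b' z \<noteq> 0"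
      if "z \<in> polydisc" for z
      using assms(3,4)[OF that] by (auto simp: ab ab' eval_mpoly_mult)
    have "(a * a') * (const_mpoly u * (reflection b * b')) = (a * a') * (const_mpoly (c * u') * (reflection b' * b))"
      using pq unfolding ab(1) ab'(1) by (simp add: reflection_mult u u' const_mpoly_mult[symmetric] mult_ac)
    then have b: "const_mpoly u * (reflection b * b') = const_mpoly (c * u') * (reflection b' * b)"
      by (rule mpoly_mult_cancel_left) (simp add: nz)
    have "reflection b * b' = const_mpoly (inverse u) * (const_mpoly (c * u') * (reflection b' * b))"
      unfolding b[symmetric] by (simp only: const_mpoly_inverse_mult[OF u(1)])
    then have "reflection b * b' = const_mpoly (inverse u * (c * u')) * (reflection b' * b)"
      by (simp only: const_mpoly_mult mult.assoc[symmetric])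
    then have "b dvd b'"
      using dvd_if_reflection_quotients_proportional[OF nz(2)] zf(2) ab(3) by blast
    moreover have "b' dvd b"
    proof -
      have "c * u' \<noteq> 0" using c u' by simp
      have "reflection b' * b = const_mpoly (inverse (c * u')) * (const_mpoly u * (reflection b * b'))"
        unfolding b by (simp only: const_mpoly_inverse_mult[OF \<open>c * u' \<noteq> 0\<close>])
      then have "reflection b' * b = const_mpoly (inverse (c * u') * u) * (reflection b * b')"
        by (simp only: const_mpoly_mult mult.assoc[symmetric])
      then show ?thesis
        using dvd_if_reflection_quotients_proportional[OF nz(4)] zf(4) ab'(3) by blast
    qed
    ultimately obtain k where k: "k \<noteq> 0" "b' = const_mpoly k * b"
      using dvd_antisym_const[of b b'] nz by blast
    have "is_atoral_factor b p" unfolding is_atoral_factor_def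
      using pnz atoralI[OF nz(2) ab(3)] self_reflective_imp_toral[OF ab(2) zf(1)] ab(1) by blast
    moreover have "is_atoral_factor b' q" unfolding is_atoral_factor_def
      using qnz atoralI[OF nz(4) ab'(3)] self_reflective_imp_toral[OF ab'(2) zf(3)] ab'(1) by blast
    ultimately show "same_atoral_factor p q \<and> h = e"
      unfolding same_atoral_factor_def using k he by blast
  }
  {
    assume "same_atoral_factor p q \<and> h = e"
    then obtain a a' b k where *: "h = e" "p = a * b" "toral a" "q = a' * (const_mpoly k * b)" "toral a'" "k \<noteq> 0"
      unfolding same_atoral_factor_def is_atoral_factor_def by blast
    have "a \<noteq> 0" "a' \<noteq> 0" using * pnz qnz by auto
    then obtain u u' where u: "u \<noteq> 0" "reflection a = const_mpoly u * a" "u' \<noteq> 0" "reflection a' = const_mpoly u' * a'"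
      using toral_imp_self_reflective * unfolding self_reflective_def by metis
    \<comment> \<open>\<open>k\<close> contributes \<open>cnj k / k\<close> to \<open>\<psi>\<close>, as the reflection is conjugate linear in constants\<close>
    define c where "c = u * k / (u' * cnj k)"
    have "\<phi> z = c * \<psi> z" if z: "z \<in> polydisc" for z
    proof -
      have "eval_mpoly a z \<noteq> 0" "eval_mpoly b z \<noteq> 0" "eval_mpoly a' z \<noteq> 0"
        using assms(3,4)[OF z] by (auto simp: * eval_mpoly_mult)
      then show ?thesis
        unfolding assms(5,6)[OF z] using u * by (simp add: c_def reflection_mult eval_mpoly_mult field_simps)
    qed
    moreover have "c \<noteq> 0" using u * by (simp add: c_def)
    ultimately show "\<exists>c. c \<noteq> 0 \<and> (\<forall>z\<in>polydisc. \<phi> z = c * \<psi> z)" by blast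
  }
qed

end
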